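(* Let $N$ be a positive integer, $\phi:\mathbb{Q}^N\to\mathbb{Q}^N$ an endomorphism and $p_\phi(X)=sX^N+a_1X^{N-1}+\ldots+a_N$ the characteristic polynomial of $\phi$ over $\mathbb{Z}$. Let $p$ be a prime and $\phi_p=\phi\otimes_{\mathbb{Q}}\mathrm{id}_{\mathbb{Q}_p}:\mathbb{Q}_p^N\to\mathbb{Q}_p^N$. Then $$h_A(\phi_p)=\log|1/s|_p.$$
   Context: $\mathbb{Q}_p$ is the field of $p$-adic numbers with $p$-adic norm $|-|_p$ (normalized by $|p|_p=1/p$). $\phi_p$ is the $\mathbb{Q}_p$-linear map with the same matrix as $\phi$. Characteristic polynomial over $\mathbb{Z}$: if $f(X)\in\mathbb{Q}[X]$ is the monic characteristic polynomial of the rational matrix of $\phi$ and $s$ is the minimum positive integer such that $sf(X)\in\mathbb{Z}[X]$, then $p_\phi(X)=sf(X)$. Algebraic entropy: let $G$ be a locally compact Abelian group with Haar measure $\mu$, $\phi:G\to G$ a continuous endomorphism, and let $\mathcal{C}(G)$ be the family of compact neighborhoods of $0$ in $G$. For $C\in\mathcal{C}(G)$ and $n\geq 1$ put $T_n(\phi,C)=C+\phi C+\ldots+\phi^{n-1}C$, $H_A(\phi,C)=\limsup_{n\to\infty}\frac{\log\mu(T_n(\phi,C))}{n}$ (independent of the choice of $\mu$), and $h_A(\phi)=\sup\{H_A(\phi,C):C\in\mathcal{C}(G)\}$. *)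

theory Defs
  imports "HOL-Analysis.Analysis" "Berlekamp_Zassenhaus.Finite_Field"
begin

section \<open>The $p$-adic absolute value on the rationals\<close>

definition padic_val :: "nat \<Rightarrow> rat \<Rightarrow> int" where
  "padic_val p x = (case quotient_of x of (a, b) \<Rightarrow>
     int (multiplicity (int p) a) - int (multiplicity (int p) b))"

definition padic_abs :: "nat \<Rightarrow> rat \<Rightarrow> real" where
  "padic_abs p x = (if x = 0 then 0 else real p powi (- padic_val p x))"

definition padic_Cauchy :: "nat \<Rightarrow> (nat \<Rightarrow> rat) \<Rightarrow> bool" where
  "padic_Cauchy p X \<longleftrightarrow> (\<forall>e>0. \<exists>k. \<forall>m\<ge>k. \<forall>n\<ge>k. padic_abs p (X m - X n) < e)"

definition padic_null :: "nat \<Rightarrow> (nat \<Rightarrow> rat) \<Rightarrow> bool" where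
  "padic_null p X \<longleftrightarrow> (\<lambda>n. padic_abs p (X n)) \<longlonglongrightarrow> 0"

definition padic_rel :: "nat \<Rightarrow> (nat \<Rightarrow> rat) \<Rightarrow> (nat \<Rightarrow> rat) \<Rightarrow> bool" where
  "padic_rel p X Y \<longleftrightarrow> padic_Cauchy p X \<and> padic_Cauchy p Y \<and> padic_null p (\<lambda>n. X n - Y n)"

context
  fixes p :: nat
  assumes p: "prime p"
begin

lemma padic_val_frac:
  assumes "a \<noteq> 0" "b \<noteq> 0"
  shows "padic_val p (of_int a / of_int b) =
    int (multiplicity (int p) a) - int (multiplicity (int p) b)"
proof -
  obtain c d where cd: "quotient_of (of_int a / of_int b) = (c, d)" by (cases "quotient_of (of_int a / of_int b)")
  have d: "d > 0" using quotient_of_denom_pos[OF cd] .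
  have eq: "(of_int a / of_int b :: rat) = of_int c / of_int d" using quotient_of_div[OF cd] .
  have "c \<noteq> 0" using eq assms d by (metis divide_eq_0_iff of_int_eq_0_iff)
  have "(of_int (a * d) :: rat) = of_int (c * b)"
    using eq assms d by (simp add: field_simps)
  then have e: "a * d = c * b" by (simp only: of_int_eq_iff)
  have pe: "prime_elem (int p)" using p by simp
  have "multiplicity (int p) a + multiplicity (int p) d = multiplicity (int p) c + multiplicity (int p) b"
    using arg_cong[OF e, of "multiplicity (int p)"] assms d \<open>c \<noteq> 0\<close>
    by (simp add: prime_elem_multiplicity_mult_distrib[OF pe])
  then show ?thesis by (simp add: padic_val_def cd)
qed

lemma padic_abs_0 [simp]: "padic_abs p 0 = 0"
  by (simp add: padic_abs_def)

lemma padic_abs_eq_0 [simp]: "padic_abs p x = 0 \<longleftrightarrow> x = 0"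
  using prime_gt_0_nat[OF p] by (simp add: padic_abs_def)

lemma padic_abs_nonneg [simp]: "padic_abs p x \<ge> 0"
  by (simp add: padic_abs_def)

lemma padic_abs_1 [simp]: "padic_abs p 1 = 1"
  using padic_val_frac[of 1 1] by (simp add: padic_abs_def)

lemma padic_abs_minus [simp]: "padic_abs p (- x) = padic_abs p x"
proof (cases "x = 0")
  case False
  obtain a b where x: "x = of_int a / of_int b" and b: "b > 0"
    by (metis quotient_of_denom_pos quotient_of_div surj_pair)
  have "a \<noteq> 0" using x False by auto
  then show ?thesis
    using padic_val_frac[of a b] padic_val_frac[of "- a" b] b False
    by (simp add: padic_abs_def x multiplicity_def)
qed simp

lemma padic_abs_diff_commute: "padic_abs p (x - y) = padic_abs p (y - x)"
  using padic_abs_minus[of "x - y"] by simp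

lemma padic_abs_mult: "padic_abs p (x * y) = padic_abs p x * padic_abs p y"
proof (cases "x = 0 \<or> y = 0")
  case False
  obtain a b where x: "x = of_int a / of_int b" and b: "b > 0"
    by (metis quotient_of_denom_pos quotient_of_div surj_pair)
  obtain c d where y: "y = of_int c / of_int d" and d: "d > 0"
    by (metis quotient_of_denom_pos quotient_of_div surj_pair)
  have ac: "a \<noteq> 0" "c \<noteq> 0" using x y False by auto
  have pe: "prime_elem (int p)" using p by simp
  have xy: "x * y = of_int (a * c) / of_int (b * d)" by (simp add: x y)
  have "padic_val p (x * y) = padic_val p x + padic_val p y"
    unfolding xy using ac b d
    by (subst padic_val_frac) (auto simp: x y padic_val_frac prime_elem_multiplicity_mult_distrib[OF pe])
  then show ?thesis
    using False prime_gt_0_nat[OF p] power_int_add[of "real p" "- padic_val p x" "- padic_val p y"]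
    by (simp add: padic_abs_def)
qed auto

lemma padic_abs_inverse: "padic_abs p (inverse x) = inverse (padic_abs p x)"
proof (cases "x = 0")
  case False
  then have "padic_abs p x * padic_abs p (inverse x) = 1"
    by (simp flip: padic_abs_mult)
  then show ?thesis by (simp add: inverse_unique)
qed simp

lemma padic_abs_ultrametric: "padic_abs p (x + y) \<le> max (padic_abs p x) (padic_abs p y)"
proof (cases "x = 0 \<or> y = 0 \<or> x + y = 0")
  case False
  obtain a b where x: "x = of_int a / of_int b" and b: "b > 0"
    by (metis quotient_of_denom_pos quotient_of_div surj_pair)
  obtain c d where y: "y = of_int c / of_int d" and d: "d > 0"
    by (metis quotient_of_denom_pos quotient_of_div surj_pair)
  have ac: "a \<noteq> 0" "c \<noteq> 0" using x y False by auto
  have pe: "prime_elem (int p)" using p by simp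
  have nu: "\<not> is_unit (int p)" using prime_gt_1_nat[OF p] by simp
  have s: "x + y = of_int (a * d + c * b) / of_int (b * d)"
    using b d by (simp add: x y field_simps)
  have n: "a * d + c * b \<noteq> 0" using False s by (metis div_0 of_int_0)
  let ?v = "multiplicity (int p)"
  have "int p ^ min (?v (a * d)) (?v (c * b)) dvd a * d + c * b"
    by (intro dvd_add) (auto intro!: multiplicity_dvd')
  then have "min (?v (a * d)) (?v (c * b)) \<le> ?v (a * d + c * b)"
    using n nu by (intro multiplicity_geI)  auto
  then have "min (padic_val p x) (padic_val p y) \<le> padic_val p (x + y)"
    unfolding s using n ac b d
    by (subst padic_val_frac) (auto simp: x y padic_val_frac prime_elem_multiplicity_mult_distrib[OF pe])
  moreover have "real p \<ge> 1" using prime_ge_1_nat[OF p] by simp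
  ultimately show ?thesis
    using False by (auto simp: padic_abs_def le_max_iff_disj min_le_iff_disj intro: power_int_increasing)
qed (auto simp: le_max_iff_disj)

lemma padic_abs_triangle: "padic_abs p (x + y) \<le> padic_abs p x + padic_abs p y"
  using padic_abs_ultrametric[of x y] padic_abs_nonneg[of x] padic_abs_nonneg[of y] by linarith

lemma padic_abs_triangle_diff: "\<bar>padic_abs p x - padic_abs p y\<bar> \<le> padic_abs p (x - y)"
  using padic_abs_triangle[of "x - y" y] padic_abs_triangle[of "y - x" x] padic_abs_diff_commute[of x y]
  by auto

lemma padic_null_const [simp]: "padic_null p (\<lambda>n. c) \<longleftrightarrow> c = 0"
  by (simp add: padic_null_def LIMSEQ_const_iff)

lemma padic_null_minus: "padic_null p X \<Longrightarrow> padic_null p (\<lambda>n. - X n)"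
  by (simp add: padic_null_def)

lemma padic_null_add:
  assumes "padic_null p X" "padic_null p Y"
  shows "padic_null p (\<lambda>n. X n + Y n)"
  unfolding padic_null_def
proof (rule tendsto_sandwich[of "\<lambda>_. 0" _ _ "\<lambda>n. padic_abs p (X n) + padic_abs p (Y n)"])
  show "(\<lambda>n. padic_abs p (X n) + padic_abs p (Y n)) \<longlonglongrightarrow> 0"
    using tendsto_add[OF assms[unfolded padic_null_def]] by simp
qed (auto simp: padic_abs_triangle)

lemma padic_null_mult_bounded:
  assumes X: "\<And>n. padic_abs p (X n) \<le> b" and Y: "padic_null p Y"
  shows "padic_null p (\<lambda>n. X n * Y n)"
  unfolding padic_null_def
proof (rule tendsto_sandwich[of "\<lambda>_. 0" _ _ "\<lambda>n. b * padic_abs p (Y n)"])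
  show "(\<lambda>n. b * padic_abs p (Y n)) \<longlonglongrightarrow> 0"
    using tendsto_mult_left[OF Y[unfolded padic_null_def], of b] by simp
qed (auto simp: padic_abs_mult mult_right_mono X)

lemma padic_Cauchy_const [simp]: "padic_Cauchy p (\<lambda>n. c)"
  by (simp add: padic_Cauchy_def)

lemma padic_Cauchy_minus: "padic_Cauchy p X \<Longrightarrow> padic_Cauchy p (\<lambda>n. - X n)"
  unfolding padic_Cauchy_def minus_diff_minus padic_abs_minus .

lemma padic_Cauchy_add:
  assumes X: "padic_Cauchy p X" and Y: "padic_Cauchy p Y"
  shows "padic_Cauchy p (\<lambda>n. X n + Y n)"
  unfolding padic_Cauchy_def
proof (intro allI impI)
  fix e :: real assume "e > 0"
  then obtain i j where i: "\<And>m n. m \<ge> i \<Longrightarrow> n \<ge> i \<Longrightarrow> padic_abs p (X m - X n) < e"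
    and j: "\<And>m n. m \<ge> j \<Longrightarrow> n \<ge> j \<Longrightarrow> padic_abs p (Y m - Y n) < e"
    using X Y unfolding padic_Cauchy_def by meson
  have "padic_abs p (X m + Y m - (X n + Y n)) < e" if "m \<ge> max i j" "n \<ge> max i j" for m n
    using padic_abs_ultrametric[of "X m - X n" "Y m - Y n"] i[of m n] j[of m n] that
    by (simp add: add_diff_add)
  then show "\<exists>k. \<forall>m\<ge>k. \<forall>n\<ge>k. padic_abs p (X m + Y m - (X n + Y n)) < e" by blast
qed

lemma padic_Cauchy_bounded:
  assumes "padic_Cauchy p X"
  shows "\<exists>b>0. \<forall>n. padic_abs p (X n) \<le> b"
proof -
  obtain k where k: "\<And>m n. m \<ge> k \<Longrightarrow> n \<ge> k \<Longrightarrow> padic_abs p (X m - X n) < 1"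
    using assms unfolding padic_Cauchy_def by (meson zero_less_one)
  let ?M = "Max ((\<lambda>n. padic_abs p (X n)) ` {..k})"
  have M: "padic_abs p (X n) \<le> ?M" if "n \<le> k" for n using that by (intro Max_ge) auto
  have "padic_abs p (X n) \<le> ?M + 1" for n
  proof (cases "n \<le> k")
    case False
    then show ?thesis
      using padic_abs_triangle[of "X n - X k" "X k"] k[of n k] M[of k] by (simp, linarith)
  qed (use M[of n] in linarith)
  moreover have "?M + 1 > 0" using M[of k] padic_abs_nonneg[of "X k"] by linarith
  ultimately show ?thesis by blast
qed

lemma padic_Cauchy_mult:
  assumes X: "padic_Cauchy p X" and Y: "padic_Cauchy p Y"
  shows "padic_Cauchy p (\<lambda>n. X n * Y n)"
  unfolding padic_Cauchy_def
proof (intro allI impI)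
  fix e :: real assume e: "e > 0"
  obtain a where a: "a > 0" "\<And>n. padic_abs p (X n) \<le> a" using padic_Cauchy_bounded[OF X] by blast
  obtain b where b: "b > 0" "\<And>n. padic_abs p (Y n) \<le> b" using padic_Cauchy_bounded[OF Y] by blast
  have "e / b > 0" "e / a > 0" using a b e by auto
  then obtain i j where i: "\<And>m n. m \<ge> i \<Longrightarrow> n \<ge> i \<Longrightarrow> padic_abs p (X m - X n) < e / b"
    and j: "\<And>m n. m \<ge> j \<Longrightarrow> n \<ge> j \<Longrightarrow> padic_abs p (Y m - Y n) < e / a"
    using X Y unfolding padic_Cauchy_def by meson
  have "padic_abs p (X m * Y m - X n * Y n) < e" if "m \<ge> max i j" "n \<ge> max i j" for m n
  proof -
    have "padic_abs p (X m * (Y m - Y n)) \<le> a * padic_abs p (Y m - Y n)"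
      using a by (simp add: padic_abs_mult mult_right_mono)
    also have "\<dots> < e" using j[of m n] that a by (simp add: field_simps)
    finally have 1: "padic_abs p (X m * (Y m - Y n)) < e" .
    have "padic_abs p ((X m - X n) * Y n) \<le> padic_abs p (X m - X n) * b"
      using b by (simp add: padic_abs_mult mult_left_mono)
    also have "\<dots> < e" using i[of m n] that b by (simp add: field_simps)
    finally have 2: "padic_abs p ((X m - X n) * Y n) < e" .
    show ?thesis
      using padic_abs_ultrametric[of "X m * (Y m - Y n)" "(X m - X n) * Y n"] 1 2
      by (simp add: mult_diff_mult)
  qed
  then show "\<exists>k. \<forall>m\<ge>k. \<forall>n\<ge>k. padic_abs p (X m * Y m - X n * Y n) < e" by blast
qed

lemma padic_Cauchy_not_null:
  assumes X: "padic_Cauchy p X" and nz: "\<not> padic_null p X"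
  shows "\<exists>b>0. \<exists>k. \<forall>n\<ge>k. b \<le> padic_abs p (X n)"
proof -
  obtain r where r: "r > 0" "\<And>k. \<exists>n\<ge>k. r \<le> padic_abs p (X n)"
    using nz unfolding padic_null_def LIMSEQ_iff by (auto simp: not_less)
  obtain k where k: "\<And>m n. m \<ge> k \<Longrightarrow> n \<ge> k \<Longrightarrow> padic_abs p (X m - X n) < r / 2"
    using X r(1) unfolding padic_Cauchy_def by (meson half_gt_zero)
  obtain m where m: "m \<ge> k" "r \<le> padic_abs p (X m)" using r(2) by blast
  have "r / 2 \<le> padic_abs p (X n)" if "n \<ge> k" for n
    using padic_abs_triangle_diff[of "X m" "X n"] k[OF m(1) that] m(2) by linarith
  then show ?thesis using r(1) half_gt_zero by blast
qed

lemma padic_abs_inverse_diff: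
  assumes "x \<noteq> 0" "y \<noteq> 0"
  shows "padic_abs p (inverse x - inverse y) = padic_abs p (x - y) / (padic_abs p x * padic_abs p y)"
  using assms
  by (simp add: inverse_diff_inverse padic_abs_mult padic_abs_inverse divide_inverse)

lemma padic_abs_inverse_diff_le:
  assumes "b > 0" "b \<le> padic_abs p x" "b \<le> padic_abs p y"
  shows "padic_abs p (inverse x - inverse y) \<le> padic_abs p (x - y) / (b * b)"
proof -
  have "x \<noteq> 0" "y \<noteq> 0" using assms by auto
  then show ?thesis
    using assms by (auto simp: padic_abs_inverse_diff intro!: divide_left_mono mult_mono mult_pos_pos)
qed

lemma padic_Cauchy_inverse:
  assumes X: "padic_Cauchy p X" and nz: "\<not> padic_null p X"
  shows "padic_Cauchy p (\<lambda>n. inverse (X n))"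
  unfolding padic_Cauchy_def
proof (intro allI impI)
  fix e :: real assume e: "e > 0"
  obtain b k where b: "b > 0" "\<And>n. n \<ge> k \<Longrightarrow> b \<le> padic_abs p (X n)"
    using padic_Cauchy_not_null[OF X nz] by blast
  have "e * (b * b) > 0" using e b by simp
  then obtain i where i: "\<And>m n. m \<ge> i \<Longrightarrow> n \<ge> i \<Longrightarrow> padic_abs p (X m - X n) < e * (b * b)"
    using X unfolding padic_Cauchy_def by meson
  have "padic_abs p (inverse (X m) - inverse (X n)) < e" if mn: "m \<ge> max i k" "n \<ge> max i k" for m n
  proof -
    have "padic_abs p (inverse (X m) - inverse (X n)) \<le> padic_abs p (X m - X n) / (b * b)"
      using mn b by (intro padic_abs_inverse_diff_le) auto
    also have "\<dots> < e" using i[of m n] mn b by (simp add: pos_divide_less_eq)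
    finally show ?thesis .
  qed
  then show "\<exists>k. \<forall>m\<ge>k. \<forall>n\<ge>k. padic_abs p (inverse (X m) - inverse (X n)) < e" by blast
qed

lemma padic_null_inverse_diff:
  assumes X: "padic_Cauchy p X" "\<not> padic_null p X"
    and Y: "padic_Cauchy p Y" "\<not> padic_null p Y"
    and XY: "padic_null p (\<lambda>n. X n - Y n)"
  shows "padic_null p (\<lambda>n. inverse (X n) - inverse (Y n))"
proof -
  obtain b k where b: "b > 0" "\<And>n. n \<ge> k \<Longrightarrow> b \<le> padic_abs p (X n)"
    using padic_Cauchy_not_null[OF X] by blast
  obtain c l where c: "c > 0" "\<And>n. n \<ge> l \<Longrightarrow> c \<le> padic_abs p (Y n)"
    using padic_Cauchy_not_null[OF Y] by blast
  let ?d = "min b c"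
  show ?thesis unfolding padic_null_def
  proof (rule tendsto_sandwich[of "\<lambda>_. 0" _ _ "\<lambda>n. padic_abs p (X n - Y n) / (?d * ?d)"])
    show "(\<lambda>n. padic_abs p (X n - Y n) / (?d * ?d)) \<longlonglongrightarrow> 0"
      using tendsto_divide_zero[OF XY[unfolded padic_null_def]] by blast
    show "\<forall>\<^sub>F n in sequentially. padic_abs p (inverse (X n) - inverse (Y n))
        \<le> padic_abs p (X n - Y n) / (?d * ?d)"
      using eventually_ge_at_top[of "max k l"]
    proof eventually_elim
      case (elim n)
      then show ?case using b c by (intro padic_abs_inverse_diff_le) (auto simp: min_le_iff_disj)
    qed
  qed auto
qed

lemma padic_null_rel:
  assumes "padic_null p (\<lambda>n. X n - Y n)"
  shows "padic_null p X \<longleftrightarrow> padic_null p Y"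
  using padic_null_add[OF assms, of Y] padic_null_add[OF padic_null_minus[OF assms], of X] by auto

lemma padic_rel_refl: "padic_Cauchy p X \<Longrightarrow> padic_rel p X X"
  by (simp add: padic_rel_def)

lemma part_equivp_padic_rel: "part_equivp (padic_rel p)"
proof (rule part_equivpI)
  show "\<exists>X. padic_rel p X X" by (rule exI[of _ "\<lambda>_. 0"]) (simp add: padic_rel_def)
  show "symp (padic_rel p)"
    by (rule sympI) (auto simp: padic_rel_def dest: padic_null_minus)
  show "transp (padic_rel p)"
    by (rule transpI) (auto simp: padic_rel_def dest: padic_null_add)
qed

lemma padic_abs_convergent:
  assumes "padic_Cauchy p X"
  shows "convergent (\<lambda>n. padic_abs p (X n))"
proof -
  have "Cauchy (\<lambda>n. padic_abs p (X n))"
  proof (rule CauchyI)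
    fix e :: real assume "e > 0"
    then obtain k where k: "\<And>m n. m \<ge> k \<Longrightarrow> n \<ge> k \<Longrightarrow> padic_abs p (X m - X n) < e"
      using assms unfolding padic_Cauchy_def by meson
    then show "\<exists>M. \<forall>m\<ge>M. \<forall>n\<ge>M. norm (padic_abs p (X m) - padic_abs p (X n)) < e"
      using padic_abs_triangle_diff le_less_trans unfolding real_norm_def by blast
  qed
  then show ?thesis by (simp add: Cauchy_convergent_iff)
qed

lemma padic_abs_lim_cong:
  assumes "padic_rel p X Y"
  shows "lim (\<lambda>n. padic_abs p (X n)) = lim (\<lambda>n. padic_abs p (Y n))"
proof -
  have Y: "(\<lambda>n. padic_abs p (Y n)) \<longlonglongrightarrow> lim (\<lambda>n. padic_abs p (Y n))"
    using assms padic_abs_convergent by (auto simp: padic_rel_def convergent_LIMSEQ_iff)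
  have "(\<lambda>n. padic_abs p (X n) - padic_abs p (Y n)) \<longlonglongrightarrow> 0"
    by (rule Lim_null_comparison[of _ "\<lambda>n. padic_abs p (X n - Y n)"])
      (use assms padic_abs_triangle_diff in \<open>auto simp: padic_rel_def padic_null_def\<close>)
  from tendsto_add[OF this Y] show ?thesis by (simp add: limI)
qed

end


section \<open>The field of $p$-adic numbers\<close>

text \<open>
  The completion of the rationals with respect to the $p$-adic absolute value: Cauchy sequences
  modulo null sequences. The prime $p$ is the cardinality of the index type.
\<close>

typedef (overloaded) 'p padic =
  "{X. padic_Cauchy CARD('p::prime_card) X} // {(X, Y). padic_rel CARD('p) X Y}"
  by (rule exI[of _ "{(X, Y). padic_rel CARD('p) X Y} `` {\<lambda>_. 0}"])
    (rule quotientI, simp add: padic_Cauchy_const[OF prime_card])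

definition Padic :: "(nat \<Rightarrow> rat) \<Rightarrow> 'p::prime_card padic" where
  "Padic X = Abs_padic {Y. padic_rel CARD('p) X Y}"

definition padic_seq :: "'p::prime_card padic \<Rightarrow> nat \<Rightarrow> rat" where
  "padic_seq x = (SOME X. X \<in> Rep_padic x)"

lemma Padic_exhaust:
  fixes x :: "'p::prime_card padic"
  obtains X where "padic_Cauchy CARD('p) X" "x = Padic X"
proof -
  obtain X where "padic_Cauchy CARD('p) X" "Rep_padic x = {Y. padic_rel CARD('p) X Y}"
    using Rep_padic[of x] by (auto simp: quotient_def)
  then show ?thesis using that unfolding Padic_def by (metis Rep_padic_inverse)
qed

lemma Rep_Padic:
  assumes "padic_Cauchy CARD('p::prime_card) X"
  shows "Rep_padic (Padic X :: 'p padic) = {Y. padic_rel CARD('p) X Y}"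
  unfolding Padic_def using assms by (subst Abs_padic_inverse) (auto simp: quotient_def)

lemma Padic_eq_iff:
  assumes "padic_Cauchy CARD('p::prime_card) X" "padic_Cauchy CARD('p) Y"
  shows "(Padic X :: 'p padic) = Padic Y \<longleftrightarrow> padic_null CARD('p) (\<lambda>n. X n - Y n)"
proof -
  note E = part_equivp_padic_rel[OF prime_card[where 'a='p]]
  have "(Padic X :: 'p padic) = Padic Y \<longleftrightarrow> padic_rel CARD('p) X = padic_rel CARD('p) Y"
    using assms by (auto simp flip: Rep_padic_inject simp: Rep_Padic fun_eq_iff)
  also have "\<dots> \<longleftrightarrow> padic_rel CARD('p) X Y"
    using E assms padic_rel_refl[OF prime_card[where 'a='p]] by (metis part_equivp_def)
  finally show ?thesis using assms by (simp add: padic_rel_def)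
qed

lemma padic_seq_in: "padic_seq x \<in> Rep_padic (x :: 'a::prime_card padic)"
proof -
  obtain X where "padic_Cauchy CARD('a) X" "x = Padic X" by (rule Padic_exhaust)
  then have "X \<in> Rep_padic x" by (simp add: Rep_Padic padic_rel_refl[OF prime_card])
  then show ?thesis unfolding padic_seq_def by (rule someI[of "\<lambda>X. X \<in> Rep_padic x"])
qed

lemma padic_seq_Padic:
  "padic_Cauchy CARD('p::prime_card) X \<Longrightarrow> padic_rel CARD('p) X (padic_seq (Padic X :: 'p padic))"
  using padic_seq_in[of "Padic X :: 'p padic"] by (simp add: Rep_Padic)

lemma padic_seq_Cauchy: "padic_Cauchy CARD('p) (padic_seq (x :: 'p::prime_card padic))"
  by (metis Padic_exhaust padic_rel_def padic_seq_Padic)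

lemma padic_seq_null:
  assumes "padic_Cauchy CARD('p::prime_card) X"
  shows "padic_null CARD('p) (\<lambda>n. padic_seq (Padic X :: 'p padic) n - X n)"
  using padic_null_minus[OF prime_card] padic_seq_Padic[OF assms] by (fastforce simp: padic_rel_def)

lemma Padic_padic_seq [simp]: "Padic (padic_seq x) = x"
proof (cases x rule: Padic_exhaust)
  case (1 X)
  then show ?thesis by (simp add: Padic_eq_iff padic_seq_Cauchy padic_seq_null)
qed

instantiation padic :: (prime_card) field
begin

definition "0 = Padic (\<lambda>_. 0)"
definition "1 = Padic (\<lambda>_. 1)"
definition "x + y = Padic (\<lambda>n. padic_seq x n + padic_seq y n)"
definition "- x = Padic (\<lambda>n. - padic_seq x n)"
definition "x * y = Padic (\<lambda>n. padic_seq x n * padic_seq y n)"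
definition "inverse x = (if x = 0 then 0 else Padic (\<lambda>n. inverse (padic_seq x n)))"
definition "(x :: 'a padic) - y = x + - y"
definition "(x :: 'a padic) div y = x * inverse y"

context
  fixes X :: "nat \<Rightarrow> rat"
  assumes X: "padic_Cauchy CARD('a) X"
begin

lemma Padic_eq_0_iff: "(Padic X :: 'a padic) = 0 \<longleftrightarrow> padic_null CARD('a) X"
  using X by (simp add: zero_padic_def Padic_eq_iff padic_Cauchy_const[OF prime_card])

lemma Padic_minus: "- (Padic X :: 'a padic) = Padic (\<lambda>n. - X n)"
  unfolding uminus_padic_def
  using padic_null_minus[OF prime_card padic_seq_null[OF X]] X
  by (subst Padic_eq_iff) (simp_all add: padic_Cauchy_minus[OF prime_card] padic_seq_Cauchy)

lemma Padic_inverse: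
  assumes nz: "\<not> padic_null CARD('a) X"
  shows "inverse (Padic X :: 'a padic) = Padic (\<lambda>n. inverse (X n))"
proof -
  let ?x = "padic_seq (Padic X :: 'a padic)"
  have "\<not> padic_null CARD('a) ?x"
    using nz padic_null_rel[OF prime_card padic_seq_null[OF X]] by simp
  then show ?thesis
    unfolding inverse_padic_def using nz X Padic_eq_0_iff
    by (simp, subst Padic_eq_iff)
      (auto intro!: padic_Cauchy_inverse[OF prime_card] padic_seq_Cauchy
        padic_null_inverse_diff[OF prime_card] padic_seq_null)
qed

end

context
  fixes X Y :: "nat \<Rightarrow> rat"
  assumes X: "padic_Cauchy CARD('a) X" and Y: "padic_Cauchy CARD('a) Y"
begin

lemma Padic_add: "(Padic X :: 'a padic) + Padic Y = Padic (\<lambda>n. X n + Y n)"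
  unfolding plus_padic_def
  using padic_null_add[OF prime_card padic_seq_null[OF X] padic_seq_null[OF Y]] X Y
  by (subst Padic_eq_iff) (simp_all add: padic_Cauchy_add[OF prime_card] padic_seq_Cauchy add_diff_add)

lemma Padic_mult: "(Padic X :: 'a padic) * Padic Y = Padic (\<lambda>n. X n * Y n)"
proof -
  let ?x = "padic_seq (Padic X :: 'a padic)" and ?y = "padic_seq (Padic Y :: 'a padic)"
  obtain b where b: "\<And>n. padic_abs CARD('a) (?x n) \<le> b"
    using padic_Cauchy_bounded[OF prime_card padic_seq_Cauchy] by blast
  obtain c where c: "\<And>n. padic_abs CARD('a) (Y n) \<le> c"
    using padic_Cauchy_bounded[OF prime_card Y] by blast
  have "padic_null CARD('a) (\<lambda>n. ?x n * (?y n - Y n) + Y n * (?x n - X n))"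
    by (intro padic_null_add[OF prime_card] padic_null_mult_bounded[OF prime_card, OF b]
        padic_null_mult_bounded[OF prime_card, OF c] padic_seq_null X Y)
  then show ?thesis
    unfolding times_padic_def using X Y
    by (subst Padic_eq_iff)
      (simp_all add: padic_Cauchy_mult[OF prime_card] padic_seq_Cauchy algebra_simps)
qed

end

instance
proof
  fix x y z :: "'a padic"
  note C = padic_Cauchy_add[OF prime_card] padic_Cauchy_minus[OF prime_card]
    padic_Cauchy_mult[OF prime_card] padic_Cauchy_const[OF prime_card]
  obtain X where X [simp]: "padic_Cauchy CARD('a) X" "x = Padic X" by (rule Padic_exhaust)
  obtain Y where Y [simp]: "padic_Cauchy CARD('a) Y" "y = Padic Y" by (rule Padic_exhaust)
  obtain Z where Z [simp]: "padic_Cauchy CARD('a) Z" "z = Padic Z" by (rule Padic_exhaust)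
  show "x + y + z = x + (y + z)" by (simp add: Padic_add C add.assoc)
  show "x + y = y + x" by (simp add: Padic_add add.commute)
  show "0 + x = x" by (simp add: zero_padic_def Padic_add C)
  show "- x + x = 0" by (simp add: zero_padic_def Padic_add Padic_minus C)
  show "x - y = x + - y" by (rule minus_padic_def)
  show "x * y * z = x * (y * z)" by (simp add: Padic_mult C mult.assoc)
  show "x * y = y * x" by (simp add: Padic_mult mult.commute)
  show "1 * x = x" by (simp add: one_padic_def Padic_mult C)
  show "(x + y) * z = x * z + y * z" by (simp add: Padic_add Padic_mult C distrib_right)
  show "(0 :: 'a padic) \<noteq> 1"
    by (simp add: zero_padic_def one_padic_def Padic_eq_iff C padic_null_const[OF prime_card])
  show "inverse (0 :: 'a padic) = 0" by (simp add: inverse_padic_def)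
  show "x div y = x * inverse y" by (rule divide_padic_def)
  show "inverse x * x = 1" if "x \<noteq> 0"
  proof -
    have nz: "\<not> padic_null CARD('a) X" using that by (simp add: Padic_eq_0_iff)
    obtain b k where b: "b > 0" "\<And>n. n \<ge> k \<Longrightarrow> b \<le> padic_abs CARD('a) (X n)"
      using padic_Cauchy_not_null[OF prime_card X(1) nz] by blast
    have "padic_null CARD('a) (\<lambda>n. inverse (X n) * X n - 1)"
      unfolding padic_null_def
    proof (rule tendsto_eventually)
      show "\<forall>\<^sub>F n in sequentially. padic_abs CARD('a) (inverse (X n) * X n - 1) = 0"
        using eventually_ge_at_top[of k]
      proof eventually_elim
        case (elim n)
        then have "X n \<noteq> 0" using b by (force simp: padic_abs_0[OF prime_card])
        then show ?case by (simp add: padic_abs_0[OF prime_card])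
      qed
    qed
    then show ?thesis
      using nz
      by (simp add: Padic_inverse Padic_mult one_padic_def Padic_eq_iff C
          padic_Cauchy_inverse[OF prime_card])
  qed
qed

end

lemma Padic_diff:
  assumes "padic_Cauchy CARD('p::prime_card) X" "padic_Cauchy CARD('p) Y"
  shows "(Padic X :: 'p padic) - Padic Y = Padic (\<lambda>n. X n - Y n)"
  using assms padic_Cauchy_minus[OF prime_card[where 'a='p], of Y]
  by (simp add: minus_padic_def Padic_minus Padic_add)

lemma of_nat_padic: "of_nat n = Padic (\<lambda>_. of_nat n)"
  by (induction n) (simp_all add: zero_padic_def one_padic_def Padic_add padic_Cauchy_const[OF prime_card])

instance padic :: (prime_card) field_char_0
proof
  show "inj (of_nat :: nat \<Rightarrow> 'a padic)"
    by (rule injI)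
      (simp add: of_nat_padic Padic_eq_iff padic_Cauchy_const[OF prime_card] padic_null_const[OF prime_card])
qed

lemma of_rat_padic: "of_rat q = (Padic (\<lambda>_. q) :: 'p::prime_card padic)"
proof -
  note C = padic_Cauchy_const[OF prime_card[where 'a='p]]
  have of_int: "of_int a = (Padic (\<lambda>_. of_int a) :: 'p padic)" for a
    by (cases a rule: int_diff_cases) (simp add: of_nat_padic Padic_diff C)
  obtain a b where q: "q = of_int a / of_int b" and b: "b > 0"
    by (metis quotient_of_denom_pos quotient_of_div surj_pair)
  show ?thesis
    using b
    by (simp add: q of_rat_divide of_int divide_padic_def Padic_inverse Padic_mult C
        padic_null_const[OF prime_card] flip: divide_inverse)
qed

definition padic_norm :: "'p::prime_card padic \<Rightarrow> real" where
  "padic_norm x = lim (\<lambda>n. padic_abs CARD('p) (padic_seq x n))"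

lemma padic_norm_Padic:
  assumes "padic_Cauchy CARD('p::prime_card) X"
  shows "(\<lambda>n. padic_abs CARD('p) (X n)) \<longlonglongrightarrow> padic_norm (Padic X :: 'p padic)"
proof -
  have "(\<lambda>n. padic_abs CARD('p) (X n)) \<longlonglongrightarrow> lim (\<lambda>n. padic_abs CARD('p) (X n))"
    using padic_abs_convergent[OF prime_card assms] by (simp add: convergent_LIMSEQ_iff)
  then show ?thesis
    unfolding padic_norm_def
    by (simp flip: padic_abs_lim_cong[OF prime_card padic_seq_Padic[OF assms]])
qed

lemma padic_norm_of_rat: "padic_norm (of_rat q :: 'p::prime_card padic) = padic_abs CARD('p) q"
  using padic_norm_Padic[OF padic_Cauchy_const[OF prime_card[where 'a='p], of q]]
  by (simp add: of_rat_padic LIMSEQ_const_iff)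

lemma padic_norm_nonneg [simp]: "padic_norm x \<ge> 0"
  using padic_norm_Padic[OF padic_seq_Cauchy, of x]
  by (auto intro!: LIMSEQ_le_const simp: padic_abs_nonneg[OF prime_card])

lemma padic_norm_eq_0 [simp]: "padic_norm x = 0 \<longleftrightarrow> x = 0"
proof (cases x rule: Padic_exhaust)
  case (1 X)
  then show ?thesis
    using padic_norm_Padic[OF 1(1)] LIMSEQ_unique by (auto simp: Padic_eq_0_iff padic_null_def)
qed

lemma padic_norm_mult: "padic_norm (x * y) = padic_norm x * padic_norm y"
proof -
  obtain X where X: "padic_Cauchy CARD('a) X" "x = Padic X" by (rule Padic_exhaust)
  obtain Y where Y: "padic_Cauchy CARD('a) Y" "y = Padic Y" by (rule Padic_exhaust)
  show ?thesis
    using tendsto_mult[OF padic_norm_Padic[OF X(1)] padic_norm_Padic[OF Y(1)]]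
      padic_norm_Padic[OF padic_Cauchy_mult[OF prime_card X(1) Y(1)]]
    by (auto simp: X Y Padic_mult padic_abs_mult[OF prime_card] intro: LIMSEQ_unique)
qed

lemma padic_norm_minus [simp]: "padic_norm (- x) = padic_norm x"
proof (cases x rule: Padic_exhaust)
  case (1 X)
  then show ?thesis
    using padic_norm_Padic[OF 1(1)] padic_norm_Padic[OF padic_Cauchy_minus[OF prime_card 1(1)]]
    by (auto simp: Padic_minus padic_abs_minus[OF prime_card] intro: LIMSEQ_unique)
qed

lemma padic_norm_diff_commute: "padic_norm (x - y) = padic_norm (y - x)"
  using padic_norm_minus[of "x - y"] by simp

lemma padic_norm_ultrametric: "padic_norm (x + y) \<le> max (padic_norm x) (padic_norm y)"
proof -
  obtain X where X: "padic_Cauchy CARD('a) X" "x = Padic X" by (rule Padic_exhaust)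
  obtain Y where Y: "padic_Cauchy CARD('a) Y" "y = Padic Y" by (rule Padic_exhaust)
  show ?thesis
    unfolding X Y
    using padic_norm_Padic[OF padic_Cauchy_add[OF prime_card X(1) Y(1)]]
      tendsto_max[OF padic_norm_Padic[OF X(1)] padic_norm_Padic[OF Y(1)]]
    by (auto simp: Padic_add X Y intro: LIMSEQ_le padic_abs_ultrametric[OF prime_card])
qed

lemma padic_norm_triangle: "padic_norm (x + y) \<le> padic_norm x + padic_norm y"
  using padic_norm_ultrametric[of x y] padic_norm_nonneg[of x] padic_norm_nonneg[of y] by linarith

instantiation padic :: (prime_card) metric_space
begin

definition dist_padic :: "'a padic \<Rightarrow> 'a padic \<Rightarrow> real" where
  "dist_padic x y = padic_norm (x - y)"

definition uniformity_padic :: "('a padic \<times> 'a padic) filter" where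
  "uniformity_padic = (INF e\<in>{0 <..}. principal {(x, y). dist x y < e})"

definition open_padic :: "'a padic set \<Rightarrow> bool" where
  "open_padic U \<longleftrightarrow> (\<forall>x\<in>U. eventually (\<lambda>(x', y). x' = x \<longrightarrow> y \<in> U) uniformity)"

instance
proof
  fix x y z :: "'a padic"
  show "dist x y = 0 \<longleftrightarrow> x = y" by (simp add: dist_padic_def)
  show "dist x y \<le> dist x z + dist y z"
    using padic_norm_triangle[of "x - z" "z - y"] padic_norm_diff_commute[of y z]
    by (simp add: dist_padic_def)
qed (simp_all only: uniformity_padic_def open_padic_def)

end

instance padic :: (prime_card) topological_ab_group_add
proof
  fix a b :: "'a padic"
  show "((\<lambda>x. fst x + snd x) \<longlongrightarrow> a + b) (nhds a \<times>\<^sub>F nhds b)"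
  proof (rule tendstoI)
    fix e :: real assume e: "e > 0"
    have "\<forall>\<^sub>F x in nhds a \<times>\<^sub>F nhds b. dist (fst x) a < e \<and> dist (snd x) b < e"
      using eventually_prodI[of "\<lambda>x. dist x a < e" "nhds a" "\<lambda>x. dist x b < e" "nhds b"] e
      by (auto simp: eventually_nhds_metric)
    then show "\<forall>\<^sub>F x in nhds a \<times>\<^sub>F nhds b. dist (fst x + snd x) (a + b) < e"
    proof eventually_elim
      case (elim x)
      then show ?case
        using padic_norm_ultrametric[of "fst x - a" "snd x - b"]
        by (auto simp: dist_padic_def add_diff_add)
    qed
  qed
  show "(uminus \<longlongrightarrow> - a) (nhds a)"
  proof (rule tendstoI)
    fix e :: real assume "e > 0"
    then show "\<forall>\<^sub>F x in nhds a. dist (- x) (- a) < e"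
      by (auto simp: eventually_nhds_metric dist_padic_def minus_diff_minus padic_norm_diff_commute[of a]
          simp del: minus_diff_eq intro!: exI[of _ e])
  qed
qed

instance padic :: (prime_card) complete_space
proof
  fix x :: "nat \<Rightarrow> 'a padic"
  assume x: "Cauchy x"
  have "\<exists>q. dist (of_rat q) (x n) < 1 / real (Suc n)" for n
  proof -
    obtain X where X: "padic_Cauchy CARD('a) X" "x n = Padic X" by (rule Padic_exhaust)
    obtain k where k: "\<And>i j. i \<ge> k \<Longrightarrow> j \<ge> k \<Longrightarrow> padic_abs CARD('a) (X i - X j) < 1 / real (Suc (Suc n))"
      using X(1) unfolding padic_Cauchy_def by (meson of_nat_0_less_iff zero_less_Suc zero_less_divide_1_iff)
    have C: "padic_Cauchy CARD('a) (\<lambda>i. X k + - X i)"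
      by (intro padic_Cauchy_add[OF prime_card] padic_Cauchy_minus[OF prime_card]
          padic_Cauchy_const[OF prime_card] X)
    have "padic_norm (Padic (\<lambda>i. X k + - X i) :: 'a padic) \<le> 1 / real (Suc (Suc n))"
      using k by (intro LIMSEQ_le_const2[OF padic_norm_Padic[OF C]]) (auto intro!: exI[of _ k] less_imp_le)
    also have "\<dots> < 1 / real (Suc n)" by (simp add: field_simps)
    finally show ?thesis
      using X by (auto simp: dist_padic_def of_rat_padic Padic_diff padic_Cauchy_const[OF prime_card]
        intro!: exI[of _ "X k"])
  qed
  then obtain q where q: "\<And>n. dist (of_rat (q n)) (x n) < 1 / real (Suc n)" by metis
  have q0: "(\<lambda>n. dist (of_rat (q n)) (x n)) \<longlonglongrightarrow> 0"
    by (rule tendsto_sandwich[OF _ _ tendsto_const LIMSEQ_Suc[OF lim_1_over_n]])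
      (use q in \<open>auto intro!: always_eventually less_imp_le simp: inverse_eq_divide\<close>)
  have Q: "padic_Cauchy CARD('a) q"
    unfolding padic_Cauchy_def
  proof (intro allI impI)
    fix e :: real assume e: "e > 0"
    then obtain i where i: "\<And>m n. m \<ge> i \<Longrightarrow> n \<ge> i \<Longrightarrow> dist (x m) (x n) < e / 3"
      using x unfolding Cauchy_def by (meson divide_pos_pos zero_less_numeral)
    obtain j where j: "\<And>n. n \<ge> j \<Longrightarrow> dist (of_rat (q n)) (x n) < e / 3"
      using order_tendstoD(2)[OF q0, of "e / 3"] e unfolding eventually_sequentially by auto
    have "padic_abs CARD('a) (q m - q n) < e" if "m \<ge> max i j" "n \<ge> max i j" for m n
    proof -
      have "dist (of_rat (q m) :: 'a padic) (of_rat (q n)) < e"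
        using i[of m n] j[of m] j[of n] that
          dist_triangle[of "of_rat (q m)" "of_rat (q n)" "x m"]
          dist_triangle[of "x m" "of_rat (q n)" "x n"]
        by (simp add: dist_commute)
      then show ?thesis by (simp add: dist_padic_def padic_norm_of_rat flip: of_rat_diff)
    qed
    then show "\<exists>k. \<forall>m\<ge>k. \<forall>n\<ge>k. padic_abs CARD('a) (q m - q n) < e" by blast
  qed
  have "(\<lambda>n. of_rat (q n) :: 'a padic) \<longlonglongrightarrow> Padic q"
  proof (rule metric_LIMSEQ_I)
    fix e :: real assume e: "e > 0"
    then obtain k where k: "\<And>m n. m \<ge> k \<Longrightarrow> n \<ge> k \<Longrightarrow> padic_abs CARD('a) (q m - q n) < e / 2"
      using Q unfolding padic_Cauchy_def by (meson half_gt_zero)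
    have "dist (of_rat (q m)) (Padic q :: 'a padic) < e" if m: "m \<ge> k" for m
    proof -
      have C: "padic_Cauchy CARD('a) (\<lambda>i. q m + - q i)"
        by (intro padic_Cauchy_add[OF prime_card] padic_Cauchy_minus[OF prime_card]
            padic_Cauchy_const[OF prime_card] Q)
      have "padic_norm (Padic (\<lambda>i. q m + - q i) :: 'a padic) \<le> e / 2"
        using k m by (intro LIMSEQ_le_const2[OF padic_norm_Padic[OF C]])
          (auto intro!: exI[of _ k] less_imp_le)
      then show ?thesis
        using e by (simp add: dist_padic_def of_rat_padic Padic_diff Q padic_Cauchy_const[OF prime_card])
    qed
    then show "\<exists>k. \<forall>n\<ge>k. dist (of_rat (q n)) (Padic q :: 'a padic) < e" by blast
  qed
  then have L: "(\<lambda>n. dist (of_rat (q n)) (x n) + dist (of_rat (q n)) (Padic q :: 'a padic)) \<longlonglongrightarrow> 0"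
    using tendsto_add[OF q0 iffD1[OF tendsto_dist_iff]] by simp
  have "(\<lambda>n. dist (x n) (Padic q)) \<longlonglongrightarrow> 0"
    by (rule tendsto_sandwich[OF _ _ tendsto_const L])
      (auto intro!: always_eventually simp: dist_triangle3)
  then have "x \<longlonglongrightarrow> Padic q" by (subst tendsto_dist_iff)
  then show "convergent x" by (rule convergentI)
qed


section \<open>Algebraic entropy\<close>

text \<open>
  A Haar measure is a nonzero translation-invariant Radon measure on the Borel sets. The sort
  constraint does not ask for continuity of the group operations: the library makes \<^typ>\<open>'a ^ 'n\<close>
  an instance of the topological group classes only for real normed \<open>'a\<close>, which would
  exclude $p$-adic vector spaces.
\<close>

definition haar_measure :: "'a::{ab_group_add, t2_space} measure \<Rightarrow> bool" where
  "haar_measure M \<longleftrightarrow>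
     sets M = sets borel \<and>
     (\<forall>K. compact K \<longrightarrow> emeasure M K < \<infinity>) \<and>
     (\<forall>A\<in>sets M. emeasure M A = (INF U\<in>{U. open U \<and> A \<subseteq> U}. emeasure M U)) \<and>
     (\<forall>U. open U \<longrightarrow> emeasure M U = (SUP K\<in>{K. compact K \<and> K \<subseteq> U}. emeasure M K)) \<and>
     (\<forall>x. \<forall>A\<in>sets M. emeasure M ((+) x ` A) = emeasure M A) \<and>
     emeasure M UNIV \<noteq> 0"

definition compact_nhds_0 :: "'a::{topological_space, zero} set set" where
  "compact_nhds_0 = {C. compact C \<and> 0 \<in> interior C}"

text \<open>
  The sum in the next definition is an iterated Minkowski sum (\<^theory>\<open>HOL-Library.Set_Algebras\<close>),
  i.e. $C + f C + \ldots + f^{n-1} C$.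
\<close>

definition trajectory :: "('a::comm_monoid_add \<Rightarrow> 'a) \<Rightarrow> 'a set \<Rightarrow> nat \<Rightarrow> 'a set" where
  "trajectory f C n = (\<Sum>k<n. (f ^^ k) ` C)"

text \<open>
  For a Haar measure \<open>M\<close>, a continuous endomorphism \<open>f\<close> and a compact neighbourhood \<open>C\<close> of 0, the
  trajectories (for positive \<open>n\<close>) have finite positive measure, so taking the real-valued measure
  and the real logarithm loses nothing. The value does not depend on the choice of \<open>M\<close>, since Haar
  measures agree up to a positive factor; it is kept as an explicit argument.
\<close>

definition alg_entropy_at ::
    "'a::{ab_group_add, t2_space} measure \<Rightarrow> ('a \<Rightarrow> 'a) \<Rightarrow> 'a set \<Rightarrow> ereal" where
  "alg_entropy_at M f C = limsup (\<lambda>n. ereal (ln (measure M (trajectory f C n)) / real n))"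

definition alg_entropy ::
    "'a::{ab_group_add, t2_space} measure \<Rightarrow> ('a \<Rightarrow> 'a) \<Rightarrow> ereal" where
  "alg_entropy M f = (SUP C\<in>compact_nhds_0. alg_entropy_at M f C)"


section \<open>Characteristic polynomial over the integers\<close>

definition charpoly :: "'a::comm_ring_1 ^ 'n ^ 'n \<Rightarrow> 'a poly" where
  "charpoly A = det (mat [:0, 1:] - map_matrix (\<lambda>a. [:a:]) A)"

definition poly_denom :: "rat poly \<Rightarrow> nat" where
  "poly_denom f = (LEAST s. s > 0 \<and> (\<exists>g. map_poly of_int g = Polynomial.smult (of_nat s) f))"

definition int_charpoly :: "(rat ^ 'n \<Rightarrow> rat ^ 'n) \<Rightarrow> int poly" where
  "int_charpoly \<phi> = (let f = charpoly (matrix \<phi>) in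
     THE g. map_poly of_int g = Polynomial.smult (of_nat (poly_denom f)) f)"


section \<open>Extension of scalars to the $p$-adic numbers\<close>

text \<open>
  After identifying the scalar extension of $\mathbb{Q}^N$ with $\mathbb{Q}_p^N$ via the standard
  bases, $\phi \otimes \mathrm{id}$ is the linear map with the same matrix as $\phi$.
\<close>

definition padic_extension :: "(rat ^ 'n \<Rightarrow> rat ^ 'n) \<Rightarrow> 'p::prime_card padic ^ 'n \<Rightarrow> 'p padic ^ 'n" where
  "padic_extension \<phi> x = map_matrix of_rat (matrix \<phi>) *v x"

end

theory Submission
  imports Defs
begin

text \<open>
  Write \<open>K\<close> for the field of \<open>p\<close>-adic numbers, \<open>O\<close> for its unit ball and \<open>T\<close> for the
  extended map, and let \<open>K[X]\<close> act on the space through \<open>T\<close>. Both sides equal the logarithm of the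
  Gauss norm (the largest \<open>p\<close>-adic norm of a coefficient) of the characteristic polynomial.

  On the arithmetic side, the characteristic polynomial is monic and \<open>s\<close> is the least common
  denominator of its coefficients. Therefore its product with \<open>s\<close> has Gauss norm 1 at every
  prime (\<open>gauss_norm_poly_denom\<close>).

  On the dynamical side the model case is \<open>K[X]/(f)\<close> with \<open>f\<close> monic and the lattice spanned over \<open>O\<close>
  by the powers \<open>X^j\<close> with \<open>j < deg f\<close>. The trajectory adds one more power of \<open>X\<close> at each step. If
  \<open>c f\<close> has Gauss norm 1, then by the Gauss lemma every integral multiple of \<open>f\<close> is an integral
  multiple of \<open>c f\<close>; hence \<open>x X^m\<close> already lies in the span of the lower powers iff \<open>c\<close> divides
  \<open>x\<close> in \<open>O\<close>, and each step multiplies the measure by exactly \<open>1/|c|\<close>, the Gauss norm of \<open>f\<close>.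

  In general the standard basis vectors span a chain of invariant subspaces whose successive
  quotients are cyclic, with annihilators \<open>f_i\<close> (\<open>exists_cyclic_flag\<close>). The relations that define
  the \<open>f_i\<close> form a triangular basis of the module of all relations among the basis vectors. The
  columns of the characteristic matrix form another basis of this module; comparing determinants,
  the characteristic polynomial is the product of the \<open>f_i\<close>
  (\<open>charpoly_eq_prod_flag\<close>). After rescaling the basis vectors the relations become integral, and
  the computation of the model case can be carried out in all quotients at once: the growth factor
  of the trajectory is exactly the product of the Gauss norms of the \<open>f_i\<close>
  (\<open>lead_mem_iff\<close>, \<open>lattice_Suc_cosets\<close>, \<open>trajectory_lattice\<close>), which is the Gauss norm of the
  characteristic polynomial. Rescaling all basis vectors by a common large factor gives lattices
  that contain any prescribed compact set and have the same growth factor, so that no compact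
  neighbourhood has larger entropy (\<open>alg_entropy_matrix\<close>).
\<close>

hide_const (open) up_ring.coeff up_ring.monom module.smult

section \<open>The action of polynomials through an endomorphism\<close>

text \<open>
  The vector \<open>h(T) v\<close>, evaluated by the Horner scheme.
\<close>

definition pact :: "('a::field ^ 'n \<Rightarrow> 'a ^ 'n) \<Rightarrow> 'a poly \<Rightarrow> 'a ^ 'n \<Rightarrow> 'a ^ 'n" where
  "pact T h v = fold_coeffs (\<lambda>a y. a *s v + T y) h 0"

locale vec_endo =
  fixes T :: "'a::field ^ 'n \<Rightarrow> 'a ^ 'n"
  assumes T_add: "T (x + y) = T x + T y"
    and T_smult: "T (c *s x) = c *s T x"
begin

abbreviation act (infixr "\<bullet>\<bullet>" 75) where "h \<bullet>\<bullet> v \<equiv> pact T h v"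

lemma T_0 [simp]: "T 0 = 0"
  using T_smult[of 0 0] by simp

lemma act_0 [simp]: "0 \<bullet>\<bullet> v = 0"
  by (simp add: pact_def)

lemma act_pCons: "pCons a h \<bullet>\<bullet> v = a *s v + T (h \<bullet>\<bullet> v)"
  by (cases "h = 0 \<and> a = 0") (auto simp: pact_def)

lemma act_const [simp]: "[:c:] \<bullet>\<bullet> v = c *s v"
  by (simp add: act_pCons)

lemma act_monom: "monom c k \<bullet>\<bullet> v = c *s (T ^^ k) v"
  by (induction k) (simp_all add: monom_0 monom_Suc act_pCons T_smult)

lemma act_add_right: "h \<bullet>\<bullet> (v + w) = h \<bullet>\<bullet> v + h \<bullet>\<bullet> w"
  by (induction h) (simp_all add: act_pCons T_add vector_add_ldistrib)

lemma act_smult_right: "h \<bullet>\<bullet> (c *s v) = c *s (h \<bullet>\<bullet> v)"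
  by (induction h) (simp_all add: act_pCons T_smult vector_add_ldistrib mult.commute)

lemma act_zero_right [simp]: "h \<bullet>\<bullet> 0 = 0"
  using act_smult_right[of h 0 0] by simp

lemma act_sum_right: "h \<bullet>\<bullet> (\<Sum>i\<in>I. w i) = (\<Sum>i\<in>I. h \<bullet>\<bullet> w i)"
  by (induction I rule: infinite_finite_induct) (simp_all add: act_add_right)

lemma act_add: "(g + h) \<bullet>\<bullet> v = g \<bullet>\<bullet> v + h \<bullet>\<bullet> v"
  by (induction g h rule: poly_induct2) (simp_all add: act_pCons T_add vector_sadd_rdistrib algebra_simps)

lemma act_smult: "smult c h \<bullet>\<bullet> v = c *s (h \<bullet>\<bullet> v)"
  by (induction h) (simp_all add: act_pCons T_smult vector_add_ldistrib)

lemma act_minus: "(- h) \<bullet>\<bullet> v = - (h \<bullet>\<bullet> v)"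
  using act_add[of h "- h" v] by (simp add: eq_neg_iff_add_eq_0 add.commute)

lemma act_diff: "(g - h) \<bullet>\<bullet> v = g \<bullet>\<bullet> v - h \<bullet>\<bullet> v"
  using act_add[of g "- h" v] by (simp add: act_minus)

lemma act_sum: "(\<Sum>i\<in>I. g i) \<bullet>\<bullet> v = (\<Sum>i\<in>I. g i \<bullet>\<bullet> v)"
  by (induction I rule: infinite_finite_induct) (simp_all add: act_add)

lemma act_mult: "(g * h) \<bullet>\<bullet> v = g \<bullet>\<bullet> h \<bullet>\<bullet> v"
  by (induction g) (simp_all add: act_pCons act_add act_smult)

text \<open>
  One more iterate of \<open>T\<close> than the dimension cannot be independent.
\<close>

lemma exists_annihilator: "\<exists>u. u \<noteq> 0 \<and> u \<bullet>\<bullet> v = 0"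
proof (cases "inj_on (\<lambda>k. (T ^^ k) v) {..CARD('n)}")
  case True
  define S where "S = (\<lambda>k. (T ^^ k) v) ` {..CARD('n)}"
  have "card S = Suc CARD('n)" unfolding S_def using True by (simp add: card_image)
  moreover have "vec.dim S \<le> CARD('n)" by (rule vec.dim_subset_UNIV[unfolded card_cart_basis vec.dimension_def vector_space_over_itself.dimension_def, THEN order_trans]) simp
  ultimately have "vec.dependent S" by (intro vec.dependent_biggerset_general) simp
  moreover have "finite S" by (simp add: S_def)
  ultimately obtain c w where c: "w \<in> S" "c w \<noteq> 0" "(\<Sum>x\<in>S. c x *s x) = 0"
    using vec.dependent_finite by blast
  define u where "u = (\<Sum>k\<le>CARD('n). monom (c ((T ^^ k) v)) k)"
  have "u \<bullet>\<bullet> v = (\<Sum>x\<in>S. c x *s x)"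
    unfolding u_def S_def by (subst sum.reindex[OF True]) (simp add: act_sum act_monom)
  moreover obtain k where "k \<le> CARD('n)" "w = (T ^^ k) v" using c(1) by (auto simp: S_def)
  then have "coeff u k = c w" by (simp add: u_def coeff_sum)
  then have "u \<noteq> 0" using c(2) by auto
  ultimately show ?thesis using c(3) by auto
next
  case False
  then obtain a b where ab: "a \<noteq> b" "(T ^^ a) v = (T ^^ b) v" by (auto simp: inj_on_def)
  have "coeff (monom (1::'a) a - monom 1 b) a \<noteq> 0" using ab by simp
  then have "monom (1::'a) a - monom 1 b \<noteq> 0" by (metis coeff_0)
  moreover have "(monom 1 a - monom 1 b) \<bullet>\<bullet> v = 0" using ab by (simp add: act_diff act_monom)
  ultimately show ?thesis by blast
qed

end

text \<open>
  Let \<open>W_i\<close> be the \<open>K[T]\<close>-span of \<open>e_0, ..., e_{i-1}\<close>. The last assumption says that \<open>f_i\<close>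
  annihilates \<open>e_i\<close> modulo \<open>W_i\<close> minimally; \<open>f_i = 1\<close> occurs exactly when \<open>e_i\<close> already lies in
  \<open>W_i\<close>. The degree bound on \<open>h i j\<close>, obtained by division by \<open>f j\<close>, will ensure that
  subtracting a multiple of the relation for \<open>e_i\<close> does not change the leading terms of the
  earlier coordinates.
\<close>

locale cyclic_flag = vec_endo T for T :: "'a::field ^ 'n \<Rightarrow> 'a ^ 'n" +
  fixes N :: nat and e :: "nat \<Rightarrow> 'a ^ 'n" and f :: "nat \<Rightarrow> 'a poly" and h :: "nat \<Rightarrow> nat \<Rightarrow> 'a poly"
  assumes monic: "i < N \<Longrightarrow> lead_coeff (f i) = 1"
    and relation: "i < N \<Longrightarrow> f i \<bullet>\<bullet> e i = (\<Sum>j<i. h i j \<bullet>\<bullet> e j)"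
    and reduced: "j < i \<Longrightarrow> i < N \<Longrightarrow> degree (f j) \<le> l \<Longrightarrow> coeff (h i j) l = 0"
    and minimal: "i < N \<Longrightarrow> (\<Sum>j\<le>i. u j \<bullet>\<bullet> e j) = 0 \<Longrightarrow> f i dvd u i"
begin

text \<open>
  Every relation is a combination of the \<open>N\<close> defining ones: the last coordinate of a relation is a
  multiple of the last \<open>f_i\<close>, and subtracting that multiple of the defining relation shortens it.
\<close>

lemma eliminate:
  assumes "k \<le> N" "(\<Sum>j<k. u j \<bullet>\<bullet> e j) = 0"
  shows "\<exists>q. \<forall>j<k. u j = f j * q j - (\<Sum>i\<in>{j<..<k}. h i j * q i)"
  using assms
proof (induction k arbitrary: u)
  case (Suc k)
  have "f k dvd u k" using minimal[of k u] Suc.prems by (simp add: lessThan_Suc_atMost)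
  then obtain p where p: "u k = f k * p" by (elim dvdE)
  define u' where "u' j = u j + h k j * p" for j
  have "(\<Sum>j<k. u' j \<bullet>\<bullet> e j) = (\<Sum>j<k. u j \<bullet>\<bullet> e j) + p \<bullet>\<bullet> f k \<bullet>\<bullet> e k"
    using Suc.prems relation[of k]
    by (simp add: u'_def act_add sum.distrib act_sum_right mult.commute[of _ p] act_mult)
  also have "\<dots> = 0" using Suc.prems by (simp add: p act_mult[symmetric] mult.commute)
  finally obtain q where q: "\<And>j. j < k \<Longrightarrow> u' j = f j * q j - (\<Sum>i\<in>{j<..<k}. h i j * q i)"
    using Suc.IH[of u'] Suc.prems by auto
  have "u j = f j * (q(k := p)) j - (\<Sum>i\<in>{j<..<Suc k}. h i j * (q(k := p)) i)" if "j < Suc k" for j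
  proof (cases "j = k")
    case True
    moreover have "{k<..<Suc k} = {}" by auto
    ultimately show ?thesis by (simp add: p)
  next
    case False
    then have "{j<..<Suc k} = insert k {j<..<k}" using that by auto
    then show ?thesis using q[of j] that False by (simp add: u'_def algebra_simps)
  qed
  then show ?case by blast
qed simp

text \<open>
  Division with remainder by the monic \<open>f_k\<close>, from the last coordinate down; the quotients are
  pushed into the earlier coordinates by the defining relations.
\<close>

lemma reduce:
  assumes "k \<le> N"
  shows "\<exists>r. (\<Sum>j<k. u j \<bullet>\<bullet> e j) = (\<Sum>j<k. r j \<bullet>\<bullet> e j) \<and>
    (\<forall>j<k. \<forall>l\<ge>degree (f j). coeff (r j) l = 0)"
  using assms
proof (induction k arbitrary: u)
  case (Suc k)
  define q r where "q = u k div f k" and "r = u k mod f k"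
  have "f k \<noteq> 0" using monic[of k] Suc.prems by auto
  then have r: "coeff r l = 0" if "l \<ge> degree (f k)" for l
    using degree_mod_less[of "f k" "u k"] that by (auto simp: r_def intro: coeff_eq_0)
  obtain s where s: "(\<Sum>j<k. (u j + q * h k j) \<bullet>\<bullet> e j) = (\<Sum>j<k. s j \<bullet>\<bullet> e j)"
      "\<And>j l. j < k \<Longrightarrow> l \<ge> degree (f j) \<Longrightarrow> coeff (s j) l = 0"
    using Suc.IH[of "\<lambda>j. u j + q * h k j"] Suc.prems by auto
  have "u k \<bullet>\<bullet> e k = q \<bullet>\<bullet> f k \<bullet>\<bullet> e k + r \<bullet>\<bullet> e k"
    by (simp add: q_def r_def flip: act_mult act_add)
  then have "(\<Sum>j<Suc k. u j \<bullet>\<bullet> e j) = (\<Sum>j<Suc k. (s(k := r)) j \<bullet>\<bullet> e j)"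
    using s(1) relation[of k] Suc.prems by (simp add: act_add sum.distrib act_mult act_sum_right)
  moreover have "\<forall>j<Suc k. \<forall>l\<ge>degree (f j). coeff ((s(k := r)) j) l = 0"
    using s(2) r by (auto simp: less_Suc_eq)
  ultimately show ?case by blast
qed simp

end

context vec_endo
begin

text \<open>
  The annihilators of \<open>e_N\<close> modulo \<open>W_N\<close> form a nonzero ideal of \<open>K[X]\<close>, and the new
  polynomial is its monic generator, found as a nonzero element of least degree.
\<close>

lemma exists_cyclic_flag: "\<exists>f h. cyclic_flag T N e f h"
proof (induction N)
  case 0
  show ?case by (rule exI[of _ "\<lambda>_. 1"], rule exI[of _ "\<lambda>_ _. 0"], unfold_locales) auto
next
  case (Suc N)
  then obtain f h where "cyclic_flag T N e f h" by blast
  then interpret cyclic_flag T N e f h .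
  define I where "I = {u. \<exists>w. u \<bullet>\<bullet> e N = (\<Sum>j<N. w j \<bullet>\<bullet> e j)}"
  have I_diff: "u - c * g \<in> I" if "u \<in> I" "g \<in> I" for u g c
  proof -
    obtain a b where "u \<bullet>\<bullet> e N = (\<Sum>j<N. a j \<bullet>\<bullet> e j)" "g \<bullet>\<bullet> e N = (\<Sum>j<N. b j \<bullet>\<bullet> e j)"
      using \<open>u \<in> I\<close> \<open>g \<in> I\<close> unfolding I_def by blast
    then have "(u - c * g) \<bullet>\<bullet> e N = (\<Sum>j<N. (a j - c * b j) \<bullet>\<bullet> e j)"
      by (simp add: act_diff act_mult act_sum_right sum_subtractf)
    then show ?thesis unfolding I_def by (intro CollectI exI[of _ "\<lambda>j. a j - c * b j"])
  qed
  have "\<exists>u. u \<in> I \<and> u \<noteq> 0"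
    using exists_annihilator[of "e N"] unfolding I_def by (auto intro!: exI[of _ "\<lambda>_. 0"])
  then obtain g where g: "g \<in> I" "g \<noteq> 0" and least: "\<And>u. u \<in> I \<Longrightarrow> u \<noteq> 0 \<Longrightarrow> degree g \<le> degree u"
    using arg_min_nat_lemma[of "\<lambda>u. u \<in> I \<and> u \<noteq> 0" _ degree] by blast
  define f' where "f' = smult (inverse (lead_coeff g)) g"
  have f': "lead_coeff f' = 1" "f' \<noteq> 0" "degree f' = degree g" using g by (auto simp: f'_def)
  have "0 \<in> I" unfolding I_def by (auto intro!: exI[of _ "\<lambda>_. 0"])
  from I_diff[OF this g(1), of "- [:inverse (lead_coeff g):]"] have f'I: "f' \<in> I"
    by (simp add: f'_def)
  have dvd: "f' dvd u" if "u \<in> I" for u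
  proof -
    have "u mod f' \<in> I" using I_diff[OF that f'I, of "u div f'"] by (simp add: minus_div_mult_eq_mod)
    then have "u mod f' = 0" using least[of "u mod f'"] degree_mod_less[of f' u] f' by force
    then show ?thesis by auto
  qed
  obtain w where w: "f' \<bullet>\<bullet> e N = (\<Sum>j<N. w j \<bullet>\<bullet> e j)" using f'I unfolding I_def by blast
  obtain r where r: "f' \<bullet>\<bullet> e N = (\<Sum>j<N. r j \<bullet>\<bullet> e j)"
     "\<And>j l. j < N \<Longrightarrow> l \<ge> degree (f j) \<Longrightarrow> coeff (r j) l = 0"
    using reduce[of N w] w by auto
  have "cyclic_flag T (Suc N) e (f(N := f')) (h(N := r))"
  proof unfold_locales
    fix i u assume i: "i < Suc N" and u: "(\<Sum>j\<le>i. u j \<bullet>\<bullet> e j) = 0"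
    show "(f(N := f')) i dvd u i"
    proof (cases "i = N")
      case True
      have "u N \<bullet>\<bullet> e N = - (\<Sum>j<N. u j \<bullet>\<bullet> e j)"
        using u True by (simp add: eq_neg_iff_add_eq_0 add.commute flip: lessThan_Suc_atMost)
      also have "\<dots> = (\<Sum>j<N. (- u j) \<bullet>\<bullet> e j)" by (simp add: act_minus sum_negf)
      finally have "u N \<in> I" unfolding I_def by (intro CollectI exI[of _ "\<lambda>j. - u j"])
      then show ?thesis using True dvd by simp
    next
      case False
      then show ?thesis using minimal[of i u] i u by simp
    qed
  next
    fix i assume i: "i < Suc N"
    show "lead_coeff ((f(N := f')) i) = 1"
      using i f'(1) monic[of i] by (cases "i = N") auto
    show "(f(N := f')) i \<bullet>\<bullet> e i = (\<Sum>j<i. (h(N := r)) i j \<bullet>\<bullet> e j)"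
      using i r(1) relation[of i] by (cases "i = N") auto
    show "coeff ((h(N := r)) i j) l = 0" if "j < i" "degree ((f(N := f')) j) \<le> l" for j l
      using i r(2)[of j l] reduced[of j i l] that by (cases "i = N") auto
  qed
  then show ?case by (intro exI)
qed

end

section \<open>The characteristic polynomial of a cyclic flag\<close>

text \<open>
  The sum of the ranks is invariant under a permutation, so no rank can drop.
\<close>

lemma permutation_rank_le_imp_id:
  fixes r :: "'n::finite \<Rightarrow> nat"
  assumes inj: "inj r" and p: "bij p" and le: "\<And>i. r (p i) \<le> r i"
  shows "p = id"
proof (rule ccontr)
  assume "p \<noteq> id"
  then obtain i where i: "p i \<noteq> i" by (auto simp: fun_eq_iff)
  then have "r (p i) < r i" using le[of i] inj by (metis injD le_neq_implies_less)
  then have "(\<Sum>i\<in>UNIV. r (p i)) < (\<Sum>i\<in>UNIV. r i)"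
    by (intro sum_strict_mono_ex1) (auto simp: le)
  moreover have "(\<Sum>i\<in>UNIV. r (p i)) = (\<Sum>i\<in>UNIV. r i)"
    by (rule sum.reindex_bij_betw[of p UNIV UNIV r]) (simp add: p)
  ultimately show False by simp
qed

text \<open>
  The index type carries no order of its own; triangularity is with respect to an arbitrary ranking.
\<close>

lemma det_triangular_rank:
  fixes R :: "'a::comm_ring_1 ^ 'n ^ 'n" and r :: "'n \<Rightarrow> nat"
  assumes inj: "inj r" and tri: "\<And>i j. r i < r j \<Longrightarrow> R $ i $ j = 0"
  shows "det R = (\<Prod>i\<in>UNIV. R $ i $ i)"
proof -
  let ?U = "UNIV :: 'n set" and ?t = "\<lambda>p. of_int (sign p) * (\<Prod>i\<in>UNIV. R $ i $ p i)"
  have "?t p = 0" if "p \<in> {p. p permutes ?U} - {id}" for p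
  proof -
    have "bij p" "p \<noteq> id" using that by (auto simp: permutes_bij)
    then obtain i where "\<not> r (p i) \<le> r i" using permutation_rank_le_imp_id[OF inj] by blast
    then have "R $ i $ p i = 0" by (intro tri) simp
    then have "(\<Prod>i\<in>UNIV. R $ i $ p i) = 0" by (intro prod_zero) auto
    then show ?thesis by simp
  qed
  then have "det R = (\<Sum>p\<in>{id}. ?t p)"
    unfolding det_def by (intro sum.mono_neutral_right) (auto simp: finite_permutations permutes_id)
  then show ?thesis by (simp add: sign_id)
qed

text \<open>
  In the expansion of the determinant only the identity permutation reaches the full degree.
\<close>

lemma charpoly_degree_coeff:
  fixes A :: "'a::idom ^ 'n ^ 'n"
  shows "degree (charpoly A) = CARD('n)" and "lead_coeff (charpoly A) = 1"
proof -
  let ?X = "mat [:0, 1:] - map_matrix (\<lambda>a. [:a:]) A"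
  let ?t = "\<lambda>p. \<Prod>i\<in>UNIV. ?X $ i $ p i"
  let ?P = "{p. p permutes (UNIV::'n set)} - {id}"
  have deg1: "degree (?X $ i $ j) \<le> (if i = j then 1 else 0)" for i j
    by (simp add: mat_def)
  have small: "degree (?t p) < CARD('n)" if p: "p \<in> ?P" for p
  proof -
    obtain i where i: "p i \<noteq> i" using p by (auto simp: fun_eq_iff)
    have "degree (?t p) \<le> (\<Sum>i\<in>UNIV. degree (?X $ i $ p i))"
      using degree_prod_sum_le[of UNIV "\<lambda>i. ?X $ i $ p i"] by (simp add: comp_def)
    also have "\<dots> \<le> (\<Sum>i\<in>UNIV. if p i = i then 1 else 0)"
    proof (rule sum_mono)
      fix j show "degree (?X $ j $ p j) \<le> (if p j = j then 1 else 0)"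
        using deg1[of j "p j"] by (simp add: eq_commute)
    qed
    also have "\<dots> < (\<Sum>i\<in>(UNIV::'n set). 1)"
      by (rule sum_strict_mono_ex1) (use i in auto)
    finally show ?thesis by simp
  qed
  define B where "B = (\<Sum>p\<in>?P. of_int (sign p) * ?t p)"
  have B: "degree B < CARD('n)"
    unfolding B_def
  proof (rule degree_sum_less)
    fix p assume "p \<in> ?P"
    have "degree (of_int (sign p) * ?t p) \<le> degree (?t p)"
      using degree_mult_le[of "of_int (sign p)" "?t p"] by simp
    then show "degree (of_int (sign p) * ?t p) < CARD('n)" using small[OF \<open>p \<in> ?P\<close>] by simp
  qed simp
  have diag: "?t id = (\<Prod>i\<in>UNIV. [:- (A $ i $ i), 1:])" by (simp add: mat_def)
  have T: "degree (?t id) = CARD('n)" "lead_coeff (?t id) = 1"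
    unfolding diag by (subst degree_prod_eq_sum_degree) (auto simp: lead_coeff_prod)
  have eq: "charpoly A = ?t id + B"
    unfolding charpoly_def det_def B_def
    by (subst sum.remove[of _ id]) (auto simp: finite_permutations permutes_id sign_id)
  show d: "degree (charpoly A) = CARD('n)"
    unfolding eq using degree_add_eq_left[of B "?t id"] B T by simp
  show "lead_coeff (charpoly A) = 1"
    unfolding d unfolding eq using T B by (simp add: coeff_eq_0)
qed

text \<open>
  Modulo the columns of \<open>X - A\<close>, multiplication by \<open>X\<close> on constant vectors is multiplication by
  \<open>A\<close>. So every polynomial vector is congruent to the constant vector obtained by letting its
  entries act on the standard basis; in particular the relations among the basis vectors are
  combinations of these columns.
\<close>

lemma relation_in_range_char_matrix:
  fixes A :: "'a::field ^ 'n ^ 'n" and u :: "'a poly ^ 'n"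
  shows "\<exists>y. u = (mat [:0, 1:] - map_matrix (\<lambda>a. [:a:]) A) *v y
    + (\<chi> i. [:(\<Sum>j\<in>UNIV. pact ((*v) A) (u $ j) (axis j 1)) $ i:])"
proof -
  interpret vec_endo "(*v) A"
    by unfold_locales (simp_all add: matrix_vector_right_distrib vector_scalar_commute)
  let ?act = "pact ((*v) A)"
  define X where "X = mat [:0, 1:] - map_matrix (\<lambda>a. [:a:]) A"
  define con :: "'a ^ 'n \<Rightarrow> 'a poly ^ 'n" where "con c = (\<chi> i. [:c $ i:])" for c
  have con_add: "con (c + d) = con c + con d" for c d by (simp add: con_def vec_eq_iff)
  have con_sum: "con (\<Sum>i\<in>I. w i) = (\<Sum>i\<in>I. con (w i))" for I :: "'n set" and w
    by (induction I rule: infinite_finite_induct) (simp_all add: con_add, simp_all add: con_def vec_eq_iff)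
  have con_axis: "con (a *s axis j 1) = [:a:] *s axis j 1" for a j
    by (simp add: con_def vec_eq_iff axis_def)
  have X_smult: "X *v (c *s y) = c *s (X *v y)" for c y
    by (simp add: vec_eq_iff matrix_vector_mult_def sum_distrib_left mult.left_commute)
  have X_sum: "X *v (\<Sum>i\<in>I. w i) = (\<Sum>i\<in>I. X *v w i)" for I :: "'n set" and w
    by (induction I rule: infinite_finite_induct) (simp_all add: matrix_vector_right_distrib)
  have shift: "[:0, 1:] *s con c = X *v con c + con (A *v c)" for c
  proof -
    have "mat [:0, 1:] *v con c = [:0, 1:] *s con c"
      by (simp add: vec_eq_iff matrix_vector_mult_def mat_def if_distrib[of "\<lambda>x. x * _"] cong: if_cong)
    moreover have "map_matrix (\<lambda>a. [:a:]) A *v con c = con (A *v c)"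
      by (simp add: vec_eq_iff matrix_vector_mult_def con_def sum_to_poly mult.commute)
    ultimately show ?thesis by (simp add: X_def matrix_vector_mult_diff_rdistrib)
  qed
  have "\<exists>y. g *s axis j 1 = X *v y + con (?act g (axis j 1))" for g j
  proof (induction g)
    case 0
    show ?case by (rule exI[of _ 0]) (simp add: con_def vec_eq_iff)
  next
    case (pCons a g)
    then obtain y where y: "g *s axis j 1 = X *v y + con (?act g (axis j 1))" by blast
    have "pCons a g *s axis j (1 :: 'a poly) = [:a:] *s axis j 1 + [:0, 1:] *s (g *s axis j 1)"
      by (simp add: vec_eq_iff axis_def)
    also have "\<dots> = X *v ([:0, 1:] *s y + con (?act g (axis j 1))) + con (?act (pCons a g) (axis j 1))"
      by (simp only: y vector_add_ldistrib shift act_pCons con_add con_axis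
          matrix_vector_right_distrib X_smult) (simp add: algebra_simps)
    finally show ?case by blast
  qed
  then obtain Y where Y: "\<And>g j. g *s axis j 1 = X *v Y g j + con (?act g (axis j 1))" by metis
  have "u = (\<Sum>j\<in>UNIV. (u $ j) *s axis j 1)" by (simp add: basis_expansion)
  also have "\<dots> = (\<Sum>j\<in>UNIV. X *v Y (u $ j) j) + con (\<Sum>j\<in>UNIV. ?act (u $ j) (axis j 1))"
    by (simp only: Y con_sum sum.distrib)
  also have "(\<Sum>j\<in>UNIV. X *v Y (u $ j) j) = X *v (\<Sum>j\<in>UNIV. Y (u $ j) j)"
    by (simp add: X_sum)
  finally show ?thesis unfolding X_def con_def by blast
qed

text \<open>
  The columns of \<open>X - A\<close> and those of the triangular matrix \<open>R\<close> of defining relations both generate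
  the module of all relations among the standard basis vectors. So each of the two matrices is a
  multiple of the other, and their determinants are associated; both are monic.
\<close>

theorem charpoly_eq_prod_flag:
  fixes A :: "'a::field ^ 'n ^ 'n"
  assumes \<sigma>: "bij_betw \<sigma> {..<CARD('n)} (UNIV :: 'n set)"
    and flag: "cyclic_flag ((*v) A) CARD('n) (\<lambda>i. axis (\<sigma> i) 1) f h"
  shows "charpoly A = (\<Prod>i<CARD('n). f i)"
proof -
  interpret cyclic_flag "(*v) A" "CARD('n)" "\<lambda>i. axis (\<sigma> i) 1" f h by (rule flag)
  let ?act = "pact ((*v) A)"
  define X where "X = mat [:0, 1:] - map_matrix (\<lambda>a. [:a:]) A"
  define r where "r = the_inv_into {..<CARD('n)} \<sigma>"
  have r_less: "r a < CARD('n)" for a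
    using the_inv_into_into[OF bij_betw_imp_inj_on[OF \<sigma>], of a "{..<CARD('n)}"] \<sigma>
    by (auto simp: r_def bij_betw_def)
  have \<sigma>r: "\<sigma> (r a) = a" for a
    using f_the_inv_into_f_bij_betw[OF \<sigma>] by (simp add: r_def)
  have r\<sigma>: "r (\<sigma> i) = i" if "i < CARD('n)" for i
    using the_inv_into_f_f[OF bij_betw_imp_inj_on[OF \<sigma>]] that by (simp add: r_def)
  have inj: "inj r" by (metis \<sigma>r injI)
  have sum_r: "(\<Sum>a\<in>UNIV. g (r a)) = (\<Sum>i<CARD('n). g i)" for g :: "nat \<Rightarrow> 'b::comm_monoid_add"
    using sum.reindex_bij_betw[OF \<sigma>, of "\<lambda>a. g (r a)"] by (simp add: r\<sigma>)
  define \<rho> where "\<rho> i j = (if j = i then f i else if j < i then - h i j else 0)" for i j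
  define R where "R = (\<chi> a b. \<rho> (r b) (r a))"
  have detR: "det R = (\<Prod>i<CARD('n). f i)"
  proof -
    have "det R = det (transpose R)" by (simp add: det_transpose)
    also have "\<dots> = (\<Prod>a\<in>UNIV. f (r a))"
      by (subst det_triangular_rank[OF inj]) (auto simp: R_def \<rho>_def transpose_def)
    also have "\<dots> = (\<Prod>i<CARD('n). f i)"
      using prod.reindex_bij_betw[OF \<sigma>, of "\<lambda>a. f (r a)"] by (simp add: r\<sigma>)
    finally show ?thesis .
  qed
  have ev: "(\<Sum>a\<in>UNIV. ?act (g a) (axis a 1)) = (\<Sum>i<CARD('n). ?act (g (\<sigma> i)) (axis (\<sigma> i) 1))" for g
    using sum.reindex_bij_betw[OF \<sigma>, of "\<lambda>a. ?act (g a) (axis a 1)"] by simp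
  have "\<exists>y. column b R = X *v y" for b
  proof -
    define i where "i = r b"
    have i: "i < CARD('n)" by (simp add: i_def r_less)
    have "(\<Sum>a\<in>UNIV. ?act (column b R $ a) (axis a 1)) = (\<Sum>j<CARD('n). ?act (\<rho> i j) (axis (\<sigma> j) 1))"
      unfolding ev by (intro sum.cong) (simp_all add: column_def R_def r\<sigma> i_def)
    also have "\<dots> = (\<Sum>j<Suc i. ?act (\<rho> i j) (axis (\<sigma> j) 1))"
      by (rule sum.mono_neutral_right) (use i in \<open>auto simp: \<rho>_def\<close>)
    also have "\<dots> = 0" using relation[OF i] by (simp add: \<rho>_def act_minus sum_negf)
    finally show ?thesis using relation_in_range_char_matrix[of "column b R" A]
      by (auto simp: X_def vec_eq_iff)
  qed
  then obtain y where y: "\<And>b. column b R = X *v y b" by metis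
  have "R = X ** (\<chi> i b. y b $ i)"
  proof -
    have "R $ a $ b = (X ** (\<chi> i b. y b $ i)) $ a $ b" for a b
      using arg_cong[OF y[of b], of "\<lambda>v. v $ a"]
      by (simp add: column_def matrix_vector_mult_def matrix_matrix_mult_def)
    then show ?thesis by (simp add: vec_eq_iff)
  qed
  then have dvd1: "charpoly A dvd det R" by (simp add: det_mul charpoly_def X_def)
  have "\<exists>q. column b X = R *v q" for b
  proof -
    have A_axis: "(A *v axis b 1) $ a = A $ a $ b" for a
      by (simp add: matrix_vector_mult_def axis_def if_distrib[of "\<lambda>x. _ * x"] cong: if_cong)
    have "(\<Sum>a\<in>UNIV. ?act (column b X $ a) (axis a 1))
      = (\<Sum>a\<in>UNIV. (if a = b then ?act [:0, 1:] (axis b 1) else 0) - (A $ a $ b) *s axis a 1)"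
      by (intro sum.cong) (auto simp: column_def X_def mat_def act_diff)
    also have "\<dots> = ?act [:0, 1:] (axis b 1) - (\<Sum>a\<in>UNIV. (A *v axis b 1) $ a *s axis a 1)"
      by (simp add: sum_subtractf A_axis)
    also have "\<dots> = 0" by (simp add: basis_expansion act_pCons)
    finally have "(\<Sum>i<CARD('n). ?act (column b X $ \<sigma> i) (axis (\<sigma> i) 1)) = 0" unfolding ev .
    then obtain q where q: "\<And>j. j < CARD('n) \<Longrightarrow>
        column b X $ \<sigma> j = f j * q j - (\<Sum>i\<in>{j<..<CARD('n)}. h i j * q i)"
      using eliminate[of "CARD('n)" "\<lambda>i. column b X $ \<sigma> i"] by auto
    have "column b X $ a = (R *v (\<chi> b. q (r b))) $ a" for a
    proof -
      define j where "j = r a"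
      have j: "j < CARD('n)" by (simp add: j_def r_less)
      have "(R *v (\<chi> b. q (r b))) $ a = (\<Sum>i<CARD('n). \<rho> i j * q i)"
        using sum_r[of "\<lambda>i. \<rho> i j * q i"] by (simp add: matrix_vector_mult_def R_def j_def)
      also have "\<dots> = (\<Sum>i\<in>insert j {j<..<CARD('n)}. \<rho> i j * q i)"
        by (rule sum.mono_neutral_right) (use j in \<open>auto simp: \<rho>_def\<close>)
      also have "\<dots> = f j * q j - (\<Sum>i\<in>{j<..<CARD('n)}. h i j * q i)"
      proof -
        have "(\<Sum>i\<in>{j<..<CARD('n)}. \<rho> i j * q i) = (\<Sum>i\<in>{j<..<CARD('n)}. - (h i j * q i))"
          by (intro sum.cong) (auto simp: \<rho>_def)
        then show ?thesis by (simp add: \<rho>_def sum_negf)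
      qed
      also have "\<dots> = column b X $ a" using q[OF j] by (simp add: j_def \<sigma>r)
      finally show ?thesis by simp
    qed
    then show ?thesis by (auto simp: vec_eq_iff)
  qed
  then obtain q where q: "\<And>b. column b X = R *v q b" by metis
  have "X = R ** (\<chi> i b. q b $ i)"
  proof -
    have "X $ a $ b = (R ** (\<chi> i b. q b $ i)) $ a $ b" for a b
      using arg_cong[OF q[of b], of "\<lambda>v. v $ a"]
      by (simp add: column_def matrix_vector_mult_def matrix_matrix_mult_def)
    then show ?thesis by (simp add: vec_eq_iff)
  qed
  then have dvd2: "det R dvd charpoly A" by (metis charpoly_def X_def det_mul dvd_triv_left)
  have "lead_coeff (det R) = 1" by (simp add: detR lead_coeff_prod monic)
  then have "det R = charpoly A"
    using poly_dvd_antisym[OF _ dvd2 dvd1] charpoly_degree_coeff(2)[of A] by simp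
  then show ?thesis by (simp add: detR)
qed

section \<open>Residues, compactness and Gauss norms over the $p$-adic numbers\<close>

lemma padic_norm_0 [simp]: "padic_norm 0 = 0"
  by simp

lemma padic_norm_1 [simp]: "padic_norm (1 :: 'p::prime_card padic) = 1"
  using padic_norm_of_rat[of 1, where 'p='p] by (simp add: padic_abs_1[OF prime_card])

lemma padic_norm_inverse: "padic_norm (inverse (x :: 'p::prime_card padic)) = inverse (padic_norm x)"
proof (cases "x = 0")
  case False
  then have "padic_norm x * padic_norm (inverse x) = 1" by (simp flip: padic_norm_mult)
  then show ?thesis by (simp add: inverse_unique)
qed simp

lemma padic_norm_divide: "padic_norm (x / y :: 'p::prime_card padic) = padic_norm x / padic_norm y"
  by (simp add: divide_inverse padic_norm_mult padic_norm_inverse)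

lemma padic_norm_power: "padic_norm (x ^ k :: 'p::prime_card padic) = padic_norm x ^ k"
  by (induction k) (simp_all add: padic_norm_mult)

lemma padic_norm_sum_le:
  fixes g :: "'b \<Rightarrow> 'p::prime_card padic"
  assumes "\<And>i. i \<in> I \<Longrightarrow> padic_norm (g i) \<le> r" "0 \<le> r"
  shows "padic_norm (\<Sum>i\<in>I. g i) \<le> r"
  using assms
proof (induction I rule: infinite_finite_induct)
  case (insert i I)
  then show ?case using padic_norm_ultrametric[of "g i" "sum g I"] by fastforce
qed auto

lemma padic_norm_sum_less:
  fixes g :: "'b \<Rightarrow> 'p::prime_card padic"
  assumes "\<And>i. i \<in> I \<Longrightarrow> padic_norm (g i) < r" "0 < r"
  shows "padic_norm (\<Sum>i\<in>I. g i) < r"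
  using assms
proof (induction I rule: infinite_finite_induct)
  case (insert i I)
  then show ?case using padic_norm_ultrametric[of "g i" "sum g I"] by fastforce
qed auto

lemma padic_norm_add_eq:
  assumes "padic_norm y < padic_norm (x :: 'p::prime_card padic)"
  shows "padic_norm (x + y) = padic_norm x"
  using padic_norm_ultrametric[of x y] padic_norm_ultrametric[of "x + y" "- y"] assms by auto

lemma padic_norm_diff_le: "padic_norm (x - y :: 'p::prime_card padic) \<le> max (padic_norm x) (padic_norm y)"
  using padic_norm_ultrametric[of x "- y"] by simp

lemma padic_norm_of_int:
  assumes "a \<noteq> 0"
  shows "padic_norm (of_int a :: 'p::prime_card padic)
    = real CARD('p) powi (- int (multiplicity (int CARD('p)) a))"
proof -
  have "padic_val CARD('p) (of_int a) = int (multiplicity (int CARD('p)) a)"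
    using padic_val_frac[OF prime_card[where 'a='p], of a 1] assms by simp
  then show ?thesis
    using padic_norm_of_rat[of "of_int a", where 'p='p] assms by (simp add: padic_abs_def)
qed

lemma card_gt_1: "real CARD('p::prime_card) > 1"
  using prime_gt_1_nat[OF prime_card[where 'a='p]] by simp

lemma power_int_le_iff:
  assumes "(b::real) > 1"
  shows "b powi m \<le> b powi n \<longleftrightarrow> m \<le> n"
  using power_int_increasing[of m n b] power_int_strict_increasing[of n m b] assms
  by (meson leD le_less_linear less_imp_le)

lemma padic_norm_of_int_le_iff:
  "padic_norm (of_int a :: 'p::prime_card padic) \<le> (1 / real CARD('p)) ^ k
    \<longleftrightarrow> int CARD('p) ^ k dvd a"
proof (cases "a = 0")
  case False
  have nu: "\<not> is_unit (int CARD('p))" using prime_gt_1_nat[OF prime_card[where 'a='p]] by simp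
  have "(1 / real CARD('p)) ^ k = real CARD('p) powi (- int k)"
    by (simp add: power_int_minus power_inverse divide_inverse)
  then have "padic_norm (of_int a :: 'p padic) \<le> (1 / real CARD('p)) ^ k
    \<longleftrightarrow> k \<le> multiplicity (int CARD('p)) a"
    by (simp add: padic_norm_of_int[OF False] power_int_le_iff[OF card_gt_1[where 'p='p]])
  then show ?thesis using power_dvd_iff_le_multiplicity[of a "int CARD('p)" k] False nu by simp
qed simp

lemma padic_norm_of_int_le_1: "padic_norm (of_int a :: 'p::prime_card padic) \<le> 1"
  using padic_norm_of_int_le_iff[of a 0, where 'p='p] by simp

lemma padic_norm_prime: "padic_norm (of_nat CARD('p) :: 'p::prime_card padic) = 1 / real CARD('p)"
  using padic_norm_of_int[of "int CARD('p)", where 'p='p] prime_gt_1_nat[OF prime_card[where 'a='p]]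
  by (simp add: multiplicity_self power_int_minus divide_inverse)

lemma padic_rat_dense:
  fixes x :: "'p::prime_card padic"
  assumes e: "e > 0"
  shows "\<exists>q. padic_norm (x - of_rat q) < e"
proof -
  note C = padic_Cauchy_const[OF prime_card[where 'a='p]] padic_Cauchy_minus[OF prime_card[where 'a='p]]
    padic_Cauchy_add[OF prime_card[where 'a='p]]
  obtain X where X: "padic_Cauchy CARD('p) X" "x = Padic X" by (rule Padic_exhaust)
  obtain k where k: "\<And>i j. i \<ge> k \<Longrightarrow> j \<ge> k \<Longrightarrow> padic_abs CARD('p) (X i - X j) < e / 2"
    using X(1) e unfolding padic_Cauchy_def by (meson half_gt_zero)
  have "padic_Cauchy CARD('p) (\<lambda>i. X i + - X k)" by (intro C X)
  then have C': "padic_Cauchy CARD('p) (\<lambda>i. X i - X k)" by simp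
  have "padic_norm (Padic (\<lambda>i. X i - X k) :: 'p padic) \<le> e / 2"
    using k by (intro LIMSEQ_le_const2[OF padic_norm_Padic[OF C']]) (auto intro!: exI[of _ k] less_imp_le)
  moreover have "x - of_rat (X k) = Padic (\<lambda>i. X i - X k)"
    by (simp add: X of_rat_padic Padic_diff C)
  ultimately show ?thesis using e by (intro exI[of _ "X k"]) simp
qed

text \<open>
  The norm is locally constant away from 0 and the rationals are dense.
\<close>

lemma padic_norm_value_group:
  assumes "x \<noteq> (0 :: 'p::prime_card padic)"
  shows "\<exists>k. padic_norm x = real CARD('p) powi k"
proof -
  have "padic_norm x > 0" using assms padic_norm_nonneg[of x] by (simp add: order_less_le)
  then obtain q where q: "padic_norm (x - of_rat q) < padic_norm x" using padic_rat_dense by blast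
  then have "padic_norm (x + - (x - of_rat q)) = padic_norm x" using padic_norm_diff_commute[of x "of_rat q"] by (intro padic_norm_add_eq) simp
  then have "padic_norm x = padic_abs CARD('p) q" using padic_norm_of_rat[of q, where 'p='p] by simp
  with \<open>padic_norm x > 0\<close> show ?thesis unfolding padic_abs_def by (metis less_irrefl)
qed

lemma padic_norm_small:
  assumes "r > 0"
  shows "\<exists>t :: 'p::prime_card padic. t \<noteq> 0 \<and> padic_norm t \<le> r"
proof -
  obtain k where "(1 / real CARD('p)) ^ k < r"
    using real_arch_pow_inv[OF assms, of "1 / real CARD('p)"] card_gt_1[where 'p='p] by auto
  then show ?thesis
    by (intro exI[of _ "of_nat CARD('p) ^ k"]) (simp add: padic_norm_power padic_norm_prime)
qed

text \<open>
  Approximate by a rational \<open>a / b\<close>; since its norm is at most 1, the reduced denominator \<open>b\<close> is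
  prime to \<open>p\<close>, hence invertible modulo \<open>p^k\<close>.
\<close>

lemma padic_int_approx:
  fixes x :: "'p::prime_card padic"
  assumes x: "padic_norm x \<le> 1"
  shows "\<exists>r < CARD('p) ^ k. padic_norm (x - of_nat r) \<le> (1 / real CARD('p)) ^ k"
proof -
  let ?p = "CARD('p)"
  have e: "(1 / real ?p) ^ k > 0" by simp
  have e1: "(1 / real ?p) ^ k \<le> 1" using card_gt_1[where 'p='p] by (intro power_le_one) auto
  obtain q where q: "padic_norm (x - of_rat q) < (1 / real ?p) ^ k" using padic_rat_dense[OF e] by blast
  have q1: "padic_norm (of_rat q :: 'p padic) \<le> 1"
    using padic_norm_diff_le[of x "x - of_rat q"] q x e1 by simp
  obtain a b where ab: "quotient_of q = (a, b)" by (cases "quotient_of q")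
  have b: "b > 0" and cop: "coprime a b" and q_eq: "q = of_int a / of_int b"
    using quotient_of_denom_pos[OF ab] quotient_of_coprime[OF ab] quotient_of_div[OF ab] by auto
  have q_eq': "(of_rat q :: 'p padic) = of_int a / of_int b" by (simp add: q_eq of_rat_divide)
  have "\<not> int ?p dvd b"
  proof
    assume dvd: "int ?p dvd b"
    then have na: "\<not> int ?p dvd a" using cop prime_card_int[where 'a='p]
      by (meson coprime_common_divisor not_prime_unit)
    have "padic_norm (of_int b :: 'p padic) \<le> 1 / ?p" using dvd padic_norm_of_int_le_iff[of b 1, where 'p='p] by simp
    moreover have "padic_norm (of_int a :: 'p padic) > 1 / ?p" using na padic_norm_of_int_le_iff[of a 1, where 'p='p] by simp
    moreover have "padic_norm (of_int b :: 'p padic) > 0" using b by (simp add: order_less_le)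
    ultimately show False using q1 by (simp add: q_eq' padic_norm_divide divide_le_eq)
  qed
  then have nb: "padic_norm (of_int b :: 'p padic) = 1" and "coprime (int ?p) b"
    using padic_norm_of_int[of b, where 'p='p] b prime_imp_coprime[OF prime_card_int[where 'a='p]]
    by (simp_all add: not_dvd_imp_multiplicity_0)
  then have cop': "coprime b (int ?p ^ k)" by (simp add: coprime_commute)
  obtain m where m: "[b * m = a] (mod int ?p ^ k)"
    using cong_solve_coprime_int[OF cop'] by (metis cong_scalar_right mult.assoc mult_1)
  define r where "r = nat (m mod int ?p ^ k)"
  have pk: "int ?p ^ k > 0" by simp
  have r: "int r = m mod int ?p ^ k" using pk by (simp add: r_def)
  have "int r < int (?p ^ k)" unfolding r using pk by simp
  then have "r < ?p ^ k" by linarith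
  have "[b * int r = b * m] (mod int ?p ^ k)" unfolding r by (intro cong_mult) (auto simp: cong_def)
  then have "[a = b * int r] (mod int ?p ^ k)" using m by (metis cong_sym cong_trans)
  then have "int ?p ^ k dvd a - b * int r" by (simp add: cong_iff_dvd_diff)
  then have "padic_norm (of_int (a - b * int r) :: 'p padic) \<le> (1 / ?p) ^ k"
    by (simp only: padic_norm_of_int_le_iff)
  moreover have "of_rat q - of_nat r = (of_int (a - b * int r) / of_int b :: 'p padic)"
    using b by (simp add: q_eq' field_simps)
  ultimately have "padic_norm (of_rat q - of_nat r :: 'p padic) \<le> (1 / ?p) ^ k"
    by (simp only: padic_norm_divide nb div_by_1)
  then have "padic_norm (x - of_nat r) \<le> (1 / ?p) ^ k"
    using padic_norm_ultrametric[of "x - of_rat q" "of_rat q - of_nat r"] q by simp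
  with \<open>r < ?p ^ k\<close> show ?thesis by blast
qed

text \<open>
  Representatives of \<open>O / c O\<close>.
\<close>

definition residue_system :: "'p::prime_card padic \<Rightarrow> 'p padic set \<Rightarrow> bool" where
  "residue_system c R \<longleftrightarrow> (\<forall>r\<in>R. padic_norm r \<le> 1) \<and>
    (\<forall>x. padic_norm x \<le> 1 \<longrightarrow> (\<exists>r\<in>R. padic_norm (x - r) \<le> padic_norm c)) \<and>
    (\<forall>r\<in>R. \<forall>r'\<in>R. padic_norm (r - r') \<le> padic_norm c \<longrightarrow> r = r')"

lemma padic_residues:
  fixes c :: "'p::prime_card padic"
  assumes c: "c \<noteq> 0" "padic_norm c \<le> 1"
  shows "\<exists>R. finite R \<and> real (card R) = 1 / padic_norm c \<and> residue_system c R"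
proof -
  let ?p = "CARD('p)"
  obtain m where m: "padic_norm c = real ?p powi m" using padic_norm_value_group[OF c(1)] by blast
  have "m \<le> 0" using c(2) power_int_le_iff[OF card_gt_1[where 'p='p], of m 0] by (simp add: m)
  define k where "k = nat (- m)"
  have "m = - int k" using \<open>m \<le> 0\<close> by (simp add: k_def)
  then have k: "padic_norm c = (1 / ?p) ^ k"
    by (simp add: m power_int_minus power_inverse divide_inverse)
  define R where "R = (of_nat :: nat \<Rightarrow> 'p padic) ` {..<?p ^ k}"
  show ?thesis
    unfolding residue_system_def
  proof (intro exI[of _ R] conjI allI ballI impI)
    show "finite R" by (simp add: R_def)
    have "real (card R) = real (?p ^ k)"
      unfolding R_def by (subst card_image) (auto simp: inj_on_def)
    then show "real (card R) = 1 / padic_norm c" by (simp add: k power_one_over)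
    show "padic_norm r \<le> 1" if "r \<in> R" for r
      using that padic_norm_of_int_le_1[of "int n" for n, where 'p='p] by (auto simp: R_def)
    show "\<exists>r\<in>R. padic_norm (x - r) \<le> padic_norm c" if "padic_norm x \<le> 1" for x
      using padic_int_approx[OF that, of k] by (auto simp: R_def k)
    show "r = r'" if "r \<in> R" "r' \<in> R" and le: "padic_norm (r - r') \<le> padic_norm c" for r r'
    proof -
      obtain i j where ij: "r = of_nat i" "r' = of_nat j" "i < ?p ^ k" "j < ?p ^ k"
        using \<open>r \<in> R\<close> \<open>r' \<in> R\<close> by (auto simp: R_def)
      have "r - r' = of_int (int i - int j)" by (simp add: ij)
      then have "int ?p ^ k dvd int i - int j" using le padic_norm_of_int_le_iff[of "int i - int j" k, where 'p='p] by (simp add: k)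
      then have "int i mod int (?p ^ k) = int j mod int (?p ^ k)" by (simp add: mod_eq_dvd_iff)
      then have "i = j" using ij by (simp flip: zmod_int)
      then show ?thesis by (simp add: ij)
    qed
  qed
qed

text \<open>
  The ball is complete, and it is totally bounded because after scaling into \<open>O\<close> every element is
  close to one of the integers below \<open>p^k\<close>.
\<close>

lemma compact_padic_ball: "compact {x :: 'p::prime_card padic. padic_norm x \<le> r}"
proof -
  let ?p = "CARD('p)" and ?B = "{x :: 'p padic. padic_norm x \<le> r}"
  have "?B = cball 0 r" by (auto simp: dist_padic_def)
  then have "closed ?B" by (metis closed_cball)
  then have "complete ?B" by (simp add: complete_eq_closed)
  moreover have "\<exists>F. finite F \<and> ?B \<subseteq> (\<Union>x\<in>F. ball x e)" if e: "e > 0" for e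
  proof -
    obtain m where "r < real ?p ^ m" using real_arch_pow[OF card_gt_1[where 'p='p]] by blast
    define t where "t = (of_nat ?p :: 'p padic) ^ m"
    have t: "t \<noteq> 0" "padic_norm t = 1 / real ?p ^ m"
      by (simp_all add: t_def padic_norm_power padic_norm_prime power_one_over)
    have "e / real ?p ^ m > 0" using e by simp
    then obtain k where k: "(1 / real ?p) ^ k < e / real ?p ^ m"
      using real_arch_pow_inv[of _ "1 / real ?p"] card_gt_1[where 'p='p] by auto
    have "\<exists>i<?p ^ k. x \<in> ball (of_nat i / t) e" if x: "padic_norm x \<le> r" for x :: "'p padic"
    proof -
      have "padic_norm (x * t) \<le> 1"
        using x \<open>r < real ?p ^ m\<close> by (simp add: padic_norm_mult t)
      then obtain i where i: "i < ?p ^ k" "padic_norm (x * t - of_nat i) \<le> (1 / real ?p) ^ k"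
        using padic_int_approx by blast
      have "of_nat i / t - x = - ((x * t - of_nat i) / t)" using t(1) by (simp add: field_simps)
      then have "padic_norm (of_nat i / t - x) = padic_norm (x * t - of_nat i) * real ?p ^ m"
        by (simp add: padic_norm_divide t)
      also have "\<dots> < e" using i(2) k by (simp add: pos_less_divide_eq)
        (metis (no_types, lifting) le_less_trans mult_right_mono of_nat_0_le_iff zero_le_power)
      finally show ?thesis using i(1) by (auto simp: dist_padic_def)
    qed
    then show ?thesis by (intro exI[of _ "(\<lambda>i. of_nat i / t) ` {..<?p ^ k}"]) blast
  qed
  ultimately show ?thesis by (simp add: compact_eq_totally_bounded)
qed

instance padic :: (prime_card) heine_borel
proof
  fix f :: "nat \<Rightarrow> 'a padic"
  assume "bounded (range f)"
  then obtain r where "\<And>n. dist 0 (f n) \<le> r" by (auto simp: bounded_any_center[of _ 0])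
  then have "\<forall>n. f n \<in> {x. padic_norm x \<le> r}" by (simp add: dist_padic_def)
  then show "\<exists>l r. strict_mono r \<and> (f \<circ> r) \<longlonglongrightarrow> l"
    using compact_padic_ball[of r, where 'p='a] unfolding compact_eq_seq_compact_metric seq_compact_def by blast
qed

definition gauss_norm :: "'p::prime_card padic poly \<Rightarrow> real" where
  "gauss_norm h = Max ((\<lambda>i. padic_norm (coeff h i)) ` {..degree h})"

lemma coeff_le_gauss_norm: "padic_norm (coeff h i) \<le> gauss_norm h"
proof (cases "i \<le> degree h")
  case False
  then have "padic_norm (coeff h i) \<le> padic_norm (coeff h 0)" by (simp add: coeff_eq_0)
  also have "\<dots> \<le> gauss_norm h" unfolding gauss_norm_def by (rule Max_ge) auto
  finally show ?thesis .
qed (auto simp: gauss_norm_def)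

lemma gauss_norm_attained: "\<exists>i. padic_norm (coeff h i) = gauss_norm h"
proof -
  have "gauss_norm h \<in> (\<lambda>i. padic_norm (coeff h i)) ` {..degree h}"
    unfolding gauss_norm_def by (rule Max_in) auto
  then show ?thesis by auto
qed

lemma gauss_norm_le_iff: "gauss_norm h \<le> r \<longleftrightarrow> (\<forall>i. padic_norm (coeff h i) \<le> r)"
  using gauss_norm_attained[of h] coeff_le_gauss_norm[of h] order_trans by metis

lemma gauss_norm_nonneg [simp]: "0 \<le> gauss_norm h"
  using coeff_le_gauss_norm[of h 0] padic_norm_nonneg order_trans by blast

lemma gauss_norm_eq_0_iff [simp]: "gauss_norm h = 0 \<longleftrightarrow> h = 0"
proof
  assume "gauss_norm h = 0"
  then have "coeff h i = 0" for i
    using coeff_le_gauss_norm[of h i] by (metis padic_norm_eq_0 padic_norm_nonneg order_antisym)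
  then show "h = 0" by (simp add: poly_eq_iff)
qed (simp add: gauss_norm_def)

lemma gauss_norm_smult: "gauss_norm (smult c h) = padic_norm c * gauss_norm h"
proof (rule antisym)
  show "gauss_norm (smult c h) \<le> padic_norm c * gauss_norm h"
    by (simp add: gauss_norm_le_iff padic_norm_mult coeff_le_gauss_norm mult_left_mono)
  obtain i where "padic_norm (coeff h i) = gauss_norm h" using gauss_norm_attained by blast
  then show "padic_norm c * gauss_norm h \<le> gauss_norm (smult c h)"
    using coeff_le_gauss_norm[of "smult c h" i] by (simp add: padic_norm_mult)
qed

text \<open>
  The Gauss lemma. Take the lowest coefficients of \<open>g\<close> and \<open>h\<close> that attain the maximal norm, say at
  \<open>i\<close> and \<open>j\<close>: in the coefficient of \<open>g * h\<close> at \<open>i + j\<close> their product strictly dominates all other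
  summands.
\<close>

lemma gauss_norm_mult: "gauss_norm (g * h) = gauss_norm g * gauss_norm h"
proof (cases "g = 0 \<or> h = 0")
  case False
  let ?G = "gauss_norm g" and ?H = "gauss_norm h"
  have pos: "?G > 0" "?H > 0" using False by (simp_all add: order_less_le)
  have "gauss_norm (g * h) \<le> ?G * ?H"
    unfolding gauss_norm_le_iff coeff_mult
    by (intro allI padic_norm_sum_le) (auto simp: padic_norm_mult coeff_le_gauss_norm intro!: mult_mono)
  moreover have "?G * ?H \<le> gauss_norm (g * h)"
  proof -
    define i where "i = (LEAST i. padic_norm (coeff g i) = ?G)"
    define j where "j = (LEAST j. padic_norm (coeff h j) = ?H)"
    have i: "padic_norm (coeff g i) = ?G" and j: "padic_norm (coeff h j) = ?H"
      unfolding i_def j_def using gauss_norm_attained by (metis (mono_tags) LeastI)+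
    have i': "padic_norm (coeff g l) < ?G" if "l < i" for l
      using not_less_Least[OF that[unfolded i_def]] coeff_le_gauss_norm[of g l] by simp
    have j': "padic_norm (coeff h l) < ?H" if "l < j" for l
      using not_less_Least[OF that[unfolded j_def]] coeff_le_gauss_norm[of h l] by simp
    have "padic_norm (coeff g l * coeff h (i + j - l)) < ?G * ?H" if l: "l \<in> {..i + j} - {i}" for l
    proof (cases "l < i")
      case True
      then have "padic_norm (coeff g l) * ?H < ?G * ?H" using i' pos by simp
      with mult_left_mono[OF coeff_le_gauss_norm padic_norm_nonneg]
      have "padic_norm (coeff g l) * padic_norm (coeff h (i + j - l)) < ?G * ?H"
        by (rule le_less_trans)
      then show ?thesis by (simp add: padic_norm_mult)
    next
      case False
      then have "i + j - l < j" using l by auto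
      then have "?G * padic_norm (coeff h (i + j - l)) < ?G * ?H" using j' pos by simp
      with mult_right_mono[OF coeff_le_gauss_norm padic_norm_nonneg]
      have "padic_norm (coeff g l) * padic_norm (coeff h (i + j - l)) < ?G * ?H"
        by (rule le_less_trans)
      then show ?thesis by (simp add: padic_norm_mult)
    qed
    then have "padic_norm (\<Sum>l\<in>{..i + j} - {i}. coeff g l * coeff h (i + j - l)) < ?G * ?H"
      using pos by (intro padic_norm_sum_less) auto
    moreover have "coeff (g * h) (i + j)
        = coeff g i * coeff h j + (\<Sum>l\<in>{..i + j} - {i}. coeff g l * coeff h (i + j - l))"
      unfolding coeff_mult by (subst sum.remove[of _ i]) auto
    ultimately have "padic_norm (coeff (g * h) (i + j)) = ?G * ?H"
      using padic_norm_add_eq[of _ "coeff g i * coeff h j"] by (simp add: padic_norm_mult i j)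
    then show ?thesis using coeff_le_gauss_norm[of "g * h" "i + j"] by simp
  qed
  ultimately show ?thesis by simp
qed auto

lemma gauss_norm_1 [simp]: "gauss_norm (1 :: 'p::prime_card padic poly) = 1"
  by (simp add: gauss_norm_def)

lemma gauss_norm_prod: "gauss_norm (\<Prod>i\<in>I. g i) = (\<Prod>i\<in>I. gauss_norm (g i))"
  by (induction I rule: infinite_finite_induct) (simp_all add: gauss_norm_mult)

lemma gauss_norm_0 [simp]: "gauss_norm 0 = 0"
  by simp

lemma gauss_norm_add_le: "gauss_norm g \<le> r \<Longrightarrow> gauss_norm h \<le> r \<Longrightarrow> gauss_norm (g + h) \<le> r"
  unfolding gauss_norm_le_iff coeff_add
  by (meson max.boundedI order_trans padic_norm_ultrametric)

lemma gauss_norm_minus [simp]: "gauss_norm (- h) = gauss_norm h"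
  using gauss_norm_smult[of "-1" h] by simp

lemma gauss_norm_diff_le: "gauss_norm g \<le> r \<Longrightarrow> gauss_norm h \<le> r \<Longrightarrow> gauss_norm (g - h) \<le> r"
  using gauss_norm_add_le[of g r "- h"] by simp

lemma gauss_norm_monom: "gauss_norm (monom a k) = padic_norm a"
proof (rule antisym)
  show "gauss_norm (monom a k) \<le> padic_norm a" by (simp add: gauss_norm_le_iff)
  show "padic_norm a \<le> gauss_norm (monom a k)" using coeff_le_gauss_norm[of "monom a k" k] by simp
qed

lemma gauss_norm_mult_le_1: "gauss_norm g \<le> 1 \<Longrightarrow> gauss_norm h \<le> 1 \<Longrightarrow> gauss_norm (g * h) \<le> 1"
  by (simp add: gauss_norm_mult mult_le_one)

lemma gauss_norm_monic_ge_1: "lead_coeff f = 1 \<Longrightarrow> 1 \<le> gauss_norm f"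
  using coeff_le_gauss_norm[of f "degree f"] by simp

section \<open>The lattices generated by an integral flag\<close>

lemma coeff_mult_eq_0_beyond:
  fixes g q :: "'a::comm_semiring_0 poly"
  assumes "\<And>l. a \<le> l \<Longrightarrow> coeff g l = 0" "\<And>l. b < l \<Longrightarrow> coeff q l = 0" "a + b \<le> l"
  shows "coeff (g * q) l = 0"
  unfolding coeff_mult
proof (rule sum.neutral, rule ballI)
  fix i assume "i \<in> {..l}"
  then have "a \<le> i \<or> b < l - i" using assms(3) by auto
  then show "coeff g i * coeff q (l - i) = 0" using assms by auto
qed

lemma (in vec_endo) act_eq_sum:
  assumes "\<And>l. m \<le> l \<Longrightarrow> coeff u l = 0"
  shows "u \<bullet>\<bullet> v = (\<Sum>l<m. coeff u l *s (T ^^ l) v)"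
proof -
  have "u = (\<Sum>l<m. monom (coeff u l) l)"
    using assms by (auto simp: poly_eq_iff coeff_sum not_less)
  then have "u \<bullet>\<bullet> v = (\<Sum>l<m. monom (coeff u l) l) \<bullet>\<bullet> v" by simp
  then show ?thesis by (simp add: act_sum act_monom)
qed

text \<open>
  The factor \<open>c i\<close> makes \<open>c i * f i\<close> a polynomial of Gauss norm 1, and the scaling factors
  \<open>t i\<close>, each small enough compared with the earlier ones, make the defining relations between the vectors \<open>t i *s e_i\<close> integral.
\<close>

locale integral_flag =
  cyclic_flag T "CARD('n)" "\<lambda>i. axis (\<sigma> i) 1" f h
  for T :: "'p::prime_card padic ^ 'n \<Rightarrow> 'p padic ^ 'n" and \<sigma> :: "nat \<Rightarrow> 'n" and f h +
  fixes t c :: "nat \<Rightarrow> 'p padic"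
  assumes bij: "bij_betw \<sigma> {..<CARD('n)} UNIV"
    and t_nz: "i < CARD('n) \<Longrightarrow> t i \<noteq> 0"
    and t_small: "j < i \<Longrightarrow> i < CARD('n) \<Longrightarrow> padic_norm (t i) * gauss_norm (h i j) \<le> padic_norm (t j)"
    and c_norm: "i < CARD('n) \<Longrightarrow> padic_norm (c i) * gauss_norm (f i) = 1"
begin

definition v where "v i = t i *s axis (\<sigma> i) 1"
definition g where "g i = smult (c i) (f i)"
definition h' where "h' i j = smult (c i * t i / t j) (h i j)"

abbreviation d where "d i \<equiv> degree (f i)"

lemma c_nz: "i < CARD('n) \<Longrightarrow> c i \<noteq> 0"
  using c_norm[of i] by auto

lemma c_le_1: "i < CARD('n) \<Longrightarrow> padic_norm (c i) \<le> 1"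
  using c_norm[of i] gauss_norm_monic_ge_1[OF monic[of i]] mult_left_mono[of 1 "gauss_norm (f i)" "padic_norm (c i)"]
  by simp

lemma g_norm: "i < CARD('n) \<Longrightarrow> gauss_norm (g i) = 1"
  using c_norm by (simp add: g_def gauss_norm_smult)

lemma h'_integral:
  assumes "j < i" "i < CARD('n)"
  shows "gauss_norm (h' i j) \<le> 1"
proof -
  have pos: "padic_norm (t j) > 0" using t_nz[of j] assms by (simp add: order_less_le)
  have "gauss_norm (h' i j) = padic_norm (c i) * (padic_norm (t i) * gauss_norm (h i j) / padic_norm (t j))"
    by (simp add: h'_def gauss_norm_smult padic_norm_mult padic_norm_divide)
  also have "\<dots> \<le> 1 * 1"
    using c_le_1[of i] t_small[OF assms] pos assms by (intro mult_mono) auto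
  finally show ?thesis by simp
qed

lemma h'_reduced: "j < i \<Longrightarrow> i < CARD('n) \<Longrightarrow> d j \<le> l \<Longrightarrow> coeff (h' i j) l = 0"
  using reduced by (simp add: h'_def)

lemma g_relation:
  assumes "i < CARD('n)"
  shows "g i \<bullet>\<bullet> v i = (\<Sum>j<i. h' i j \<bullet>\<bullet> v j)"
proof -
  have "g i \<bullet>\<bullet> v i = (c i * t i) *s (f i \<bullet>\<bullet> axis (\<sigma> i) 1)"
    by (simp add: g_def v_def act_smult act_smult_right mult.commute)
  also have "\<dots> = (\<Sum>j<i. (c i * t i) *s (h i j \<bullet>\<bullet> axis (\<sigma> j) 1))"
    by (simp add: relation[OF assms] vec.scale_sum_right)
  also have "\<dots> = (\<Sum>j<i. h' i j \<bullet>\<bullet> v j)"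
    using t_nz assms by (intro sum.cong) (auto simp: h'_def v_def act_smult act_smult_right)
  finally show ?thesis .
qed

lemma v_minimal:
  assumes "i < CARD('n)" "(\<Sum>j\<le>i. u j \<bullet>\<bullet> v j) = 0"
  shows "g i dvd u i"
proof -
  have "(\<Sum>j\<le>i. smult (t j) (u j) \<bullet>\<bullet> axis (\<sigma> j) 1) = 0"
    using assms(2) by (simp add: v_def act_smult act_smult_right)
  then have "f i dvd smult (t i) (u i)" using minimal[OF assms(1), of "\<lambda>j. smult (t j) (u j)"] by simp
  then show ?thesis using t_nz c_nz assms(1) by (simp add: g_def smult_dvd_iff dvd_smult_iff)
qed

text \<open>
  The bound on the degrees allows \<open>n\<close> powers of \<open>T\<close> more for each generator than a basis
  of the space needs. With this bound the passage from \<open>n\<close> to \<open>Suc n\<close> adds exactly one new power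
  for each generator, even for those with \<open>f i = 1\<close>.
\<close>

definition lattice where
  "lattice n = {(\<Sum>i<CARD('n). u i \<bullet>\<bullet> v i) | u. \<forall>i<CARD('n). gauss_norm (u i) \<le> 1 \<and> (\<forall>l\<ge>n + d i. coeff (u i) l = 0)}"

lemma lattice_I:
  assumes "\<And>i. i < CARD('n) \<Longrightarrow> gauss_norm (u i) \<le> 1" "\<And>i l. i < CARD('n) \<Longrightarrow> n + d i \<le> l \<Longrightarrow> coeff (u i) l = 0"
  shows "(\<Sum>i<CARD('n). u i \<bullet>\<bullet> v i) \<in> lattice n"
  using assms unfolding lattice_def by blast

lemma lattice_E:
  assumes "x \<in> lattice n"
  obtains u where "x = (\<Sum>i<CARD('n). u i \<bullet>\<bullet> v i)" "\<And>i. i < CARD('n) \<Longrightarrow> gauss_norm (u i) \<le> 1"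
    "\<And>i l. i < CARD('n) \<Longrightarrow> n + d i \<le> l \<Longrightarrow> coeff (u i) l = 0"
  using assms unfolding lattice_def by blast

lemma lattice_add: assumes "x \<in> lattice n" "y \<in> lattice n" shows "x + y \<in> lattice n"
proof -
  obtain u where u: "x = (\<Sum>i<CARD('n). u i \<bullet>\<bullet> v i)" "\<And>i. i < CARD('n) \<Longrightarrow> gauss_norm (u i) \<le> 1"
    "\<And>i l. i < CARD('n) \<Longrightarrow> n + d i \<le> l \<Longrightarrow> coeff (u i) l = 0" by (rule lattice_E[OF assms(1)]) blast
  obtain w where w: "y = (\<Sum>i<CARD('n). w i \<bullet>\<bullet> v i)" "\<And>i. i < CARD('n) \<Longrightarrow> gauss_norm (w i) \<le> 1"
    "\<And>i l. i < CARD('n) \<Longrightarrow> n + d i \<le> l \<Longrightarrow> coeff (w i) l = 0" by (rule lattice_E[OF assms(2)]) blast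
  have "(\<Sum>i<CARD('n). (u i + w i) \<bullet>\<bullet> v i) \<in> lattice n"
    by (rule lattice_I) (simp_all add: u w gauss_norm_add_le)
  then show ?thesis by (simp add: u(1) w(1) act_add sum.distrib)
qed

lemma lattice_minus: assumes "x \<in> lattice n" shows "- x \<in> lattice n"
proof -
  obtain u where u: "x = (\<Sum>i<CARD('n). u i \<bullet>\<bullet> v i)" "\<And>i. i < CARD('n) \<Longrightarrow> gauss_norm (u i) \<le> 1"
    "\<And>i l. i < CARD('n) \<Longrightarrow> n + d i \<le> l \<Longrightarrow> coeff (u i) l = 0" by (rule lattice_E[OF assms]) blast
  have "(\<Sum>i<CARD('n). (- u i) \<bullet>\<bullet> v i) \<in> lattice n"
    by (rule lattice_I) (simp_all add: u)
  then show ?thesis by (simp add: u(1) act_minus sum_negf)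
qed

lemma lattice_diff: "x \<in> lattice n \<Longrightarrow> y \<in> lattice n \<Longrightarrow> x - y \<in> lattice n"
  using lattice_add[of x n "- y"] lattice_minus[of y n] by simp

lemma lattice_0 [simp]: "0 \<in> lattice n"
  using lattice_I[of "\<lambda>_. 0" n] by simp

lemma lattice_sum: "(\<And>i. i \<in> I \<Longrightarrow> w i \<in> lattice n) \<Longrightarrow> (\<Sum>i\<in>I. w i) \<in> lattice n"
  by (induction I rule: infinite_finite_induct) (auto simp: lattice_add)

lemma lattice_single:
  assumes "i < CARD('n)" "gauss_norm u \<le> 1" "\<And>l. n + d i \<le> l \<Longrightarrow> coeff u l = 0"
  shows "u \<bullet>\<bullet> v i \<in> lattice n"
proof -
  have "(\<Sum>j<CARD('n). (if j = i then u else 0) \<bullet>\<bullet> v j) \<in> lattice n" using assms by (intro lattice_I) auto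
  also have "(\<Sum>j<CARD('n). (if j = i then u else 0) \<bullet>\<bullet> v j) = (\<Sum>j<CARD('n). if j = i then u \<bullet>\<bullet> v i else 0)"
    by (intro sum.cong) auto
  finally show ?thesis using assms(1) by simp
qed

lemma lattice_mono: "n \<le> m \<Longrightarrow> lattice n \<subseteq> lattice m"
proof
  fix x assume nm: "n \<le> m" and "x \<in> lattice n"
  then obtain u where u: "x = (\<Sum>i<CARD('n). u i \<bullet>\<bullet> v i)" "\<And>i. i < CARD('n) \<Longrightarrow> gauss_norm (u i) \<le> 1"
    "\<And>i l. i < CARD('n) \<Longrightarrow> n + d i \<le> l \<Longrightarrow> coeff (u i) l = 0" by (elim lattice_E) blast
  show "x \<in> lattice m" unfolding u(1) using nm by (intro lattice_I u) auto
qed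

definition lead where "lead n \<xi> = (\<Sum>i<CARD('n). monom (\<xi> i) (n + d i) \<bullet>\<bullet> v i)"

lemma lead_diff: "lead n \<xi> - lead n \<zeta> = lead n (\<lambda>i. \<xi> i - \<zeta> i)"
  by (simp add: lead_def diff_monom[symmetric] act_diff sum_subtractf)

lemma lead_mem_Suc:
  assumes "\<And>i. i < CARD('n) \<Longrightarrow> padic_norm (\<xi> i) \<le> 1"
  shows "lead n \<xi> \<in> lattice (Suc n)"
  unfolding lead_def using assms by (intro lattice_I) (auto simp: gauss_norm_monom)

lemma lattice_Suc_split:
  assumes "x \<in> lattice (Suc n)"
  obtains y \<xi> where "y \<in> lattice n" "\<And>i. i < CARD('n) \<Longrightarrow> padic_norm (\<xi> i) \<le> 1" "x = y + lead n \<xi>"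
proof -
  obtain u where u: "x = (\<Sum>i<CARD('n). u i \<bullet>\<bullet> v i)" "\<And>i. i < CARD('n) \<Longrightarrow> gauss_norm (u i) \<le> 1"
    "\<And>i l. i < CARD('n) \<Longrightarrow> Suc n + d i \<le> l \<Longrightarrow> coeff (u i) l = 0" by (rule lattice_E[OF assms]) blast
  define \<xi> where "\<xi> i = coeff (u i) (n + d i)" for i
  define w where "w i = u i - monom (\<xi> i) (n + d i)" for i
  have \<xi>: "padic_norm (\<xi> i) \<le> 1" if "i < CARD('n)" for i
    using coeff_le_gauss_norm[of "u i" "n + d i"] u(2)[OF that] by (simp add: \<xi>_def)
  have "(\<Sum>i<CARD('n). w i \<bullet>\<bullet> v i) \<in> lattice n"
  proof (rule lattice_I)
    fix i assume i: "i < CARD('n)"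
    show "gauss_norm (w i) \<le> 1"
      unfolding w_def using u(2) \<xi> i by (intro gauss_norm_diff_le) (simp_all add: gauss_norm_monom)
    show "coeff (w i) l = 0" if "n + d i \<le> l" for l
      using that u(3)[OF i, of l] by (cases "l = n + d i") (simp_all add: w_def \<xi>_def)
  qed
  moreover have "x = (\<Sum>i<CARD('n). w i \<bullet>\<bullet> v i) + lead n \<xi>"
    by (simp add: u(1) w_def lead_def act_diff sum_subtractf)
  ultimately show thesis using \<xi> that by blast
qed

text \<open>
  The Gauss lemma enters here: the last coordinate of an integral relation is \<open>g k * q\<close> with \<open>q\<close>
  integral, so its leading coefficient is divisible by \<open>c k\<close>. Subtracting \<open>q\<close> times the
  defining relation leaves the leading coefficients of the other coordinates unchanged, because
  of the degree bound on \<open>h'\<close>.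
\<close>

lemma relation_lead_coeff_le:
  assumes "k \<le> CARD('n)" "(\<Sum>j<k. u j \<bullet>\<bullet> v j) = 0"
    and "\<And>j. j < k \<Longrightarrow> gauss_norm (u j) \<le> 1" "\<And>j l. j < k \<Longrightarrow> Suc n + d j \<le> l \<Longrightarrow> coeff (u j) l = 0"
  shows "\<forall>j<k. padic_norm (coeff (u j) (n + d j)) \<le> padic_norm (c j)"
  using assms
proof (induction k arbitrary: u)
  case (Suc k)
  have k: "k < CARD('n)" using Suc.prems by simp
  have "g k dvd u k" using v_minimal[of k u] Suc.prems by (simp add: lessThan_Suc_atMost)
  then obtain q where q: "u k = g k * q" by (elim dvdE)
  have q1: "gauss_norm q \<le> 1" using Suc.prems(3)[of k] g_norm[OF k] by (simp add: q gauss_norm_mult)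
  have dg: "degree (g k) = d k" "coeff (g k) (d k) = c k"
    using c_nz[OF k] monic[OF k] by (simp_all add: g_def)
  have "g k \<noteq> 0" using g_norm[OF k] by auto
  have deg_q: "q = 0 \<or> degree q \<le> n"
  proof (rule disjCI)
    assume "\<not> degree q \<le> n"
    then have "coeff (u k) (degree (u k)) = 0" if "q \<noteq> 0"
      using that \<open>g k \<noteq> 0\<close> dg by (intro Suc.prems(4)) (simp_all add: q degree_mult_eq)
    then show "q = 0" using \<open>g k \<noteq> 0\<close> by (auto simp: q)
  qed
  then have q_coeff: "coeff q l = 0" if "n < l" for l using that by (auto intro: coeff_eq_0)
  have "coeff (u k) (n + d k) = c k * coeff q n"
  proof (cases "degree q = n")
    case True
    then show ?thesis using coeff_mult_degree_sum[of "g k" q] dg by (simp add: q add.commute)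
  next
    case False
    then have "coeff q n = 0" using deg_q by (auto intro: coeff_eq_0)
    moreover have "coeff (u k) (n + d k) = 0"
    proof (cases "q = 0")
      case False
      with \<open>degree q \<noteq> n\<close> deg_q have "degree (u k) < n + d k"
        using dg \<open>g k \<noteq> 0\<close> by (simp add: q degree_mult_eq)
      then show ?thesis by (rule coeff_eq_0)
    qed (simp add: q)
    ultimately show ?thesis by simp
  qed
  then have lead_k: "padic_norm (coeff (u k) (n + d k)) \<le> padic_norm (c k)"
    using coeff_le_gauss_norm[of q n] q1 by (simp add: padic_norm_mult mult_left_le)
  define w where "w j = u j + h' k j * q" for j
  have Hq: "coeff (h' k j * q) l = 0" if "j < k" "n + d j \<le> l" for j l
    using that h'_reduced[OF that(1) k] q_coeff
    by (intro coeff_mult_eq_0_beyond[where a = "d j" and b = n]) auto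
  have "(\<Sum>j<k. w j \<bullet>\<bullet> v j) = (\<Sum>j<k. u j \<bullet>\<bullet> v j) + q \<bullet>\<bullet> g k \<bullet>\<bullet> v k"
    using g_relation[OF k]
    by (simp add: w_def act_add sum.distrib act_sum_right mult.commute[of _ q] act_mult)
  also have "\<dots> = 0" using Suc.prems(2) by (simp add: q act_mult[symmetric] mult.commute)
  finally have "\<forall>j<k. padic_norm (coeff (w j) (n + d j)) \<le> padic_norm (c j)"
  proof (intro Suc.IH)
    fix j assume j: "j < k"
    show "gauss_norm (w j) \<le> 1"
      unfolding w_def using Suc.prems(3) h'_integral[OF j k] q1 j
      by (intro gauss_norm_add_le gauss_norm_mult_le_1) auto
    show "coeff (w j) l = 0" if "Suc n + d j \<le> l" for l
      using Suc.prems(4)[of j l] Hq[OF j, of l] that j by (simp add: w_def)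
  qed (use k in auto)
  then show ?case using Hq lead_k by (auto simp: less_Suc_eq w_def)
qed simp

text \<open>
  If the leading terms are absorbed by the lattice, subtracting gives an integral relation with
  these leading coefficients. Conversely \<open>g i\<close> has leading coefficient \<open>c i\<close>, so multiples of
  the defining relations express such leading terms by lower ones.
\<close>

lemma lead_mem_iff:
  assumes "\<And>i. i < CARD('n) \<Longrightarrow> padic_norm (\<xi> i) \<le> 1"
  shows "lead n \<xi> \<in> lattice n \<longleftrightarrow> (\<forall>i<CARD('n). padic_norm (\<xi> i) \<le> padic_norm (c i))"
proof
  assume "lead n \<xi> \<in> lattice n"
  then obtain u where u: "lead n \<xi> = (\<Sum>i<CARD('n). u i \<bullet>\<bullet> v i)" "\<And>i. i < CARD('n) \<Longrightarrow> gauss_norm (u i) \<le> 1"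
    "\<And>i l. i < CARD('n) \<Longrightarrow> n + d i \<le> l \<Longrightarrow> coeff (u i) l = 0" by (rule lattice_E) blast
  have "\<forall>i<CARD('n). padic_norm (coeff (monom (\<xi> i) (n + d i) - u i) (n + d i)) \<le> padic_norm (c i)"
  proof (rule relation_lead_coeff_le)
    show "(\<Sum>i<CARD('n). (monom (\<xi> i) (n + d i) - u i) \<bullet>\<bullet> v i) = 0"
      using u(1) by (simp add: act_diff sum_subtractf lead_def)
    show "gauss_norm (monom (\<xi> i) (n + d i) - u i) \<le> 1" if "i < CARD('n)" for i
      using u(2) assms that by (intro gauss_norm_diff_le) (simp_all add: gauss_norm_monom)
  qed (use u(3) in auto)
  then show "\<forall>i<CARD('n). padic_norm (\<xi> i) \<le> padic_norm (c i)" using u(3) by simp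
next
  assume le: "\<forall>i<CARD('n). padic_norm (\<xi> i) \<le> padic_norm (c i)"
  show "lead n \<xi> \<in> lattice n"
    unfolding lead_def
  proof (rule lattice_sum)
    fix i assume "i \<in> {..<CARD('n)}"
    then have i: "i < CARD('n)" by simp
    define y where "y = \<xi> i / c i"
    have y: "padic_norm y \<le> 1" "\<xi> i = y * c i" 
      using le i c_nz[OF i] by (simp_all add: y_def padic_norm_divide divide_le_eq order_less_le)
    have "(monom (\<xi> i) (n + d i) - monom y n * g i) \<bullet>\<bullet> v i \<in> lattice n"
    proof (rule lattice_single[OF i])
      show "gauss_norm (monom (\<xi> i) (n + d i) - monom y n * g i) \<le> 1"
        using assms[OF i] y g_norm[OF i]
        by (intro gauss_norm_diff_le gauss_norm_mult_le_1) (simp_all add: gauss_norm_monom)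
      show "coeff (monom (\<xi> i) (n + d i) - monom y n * g i) l = 0" if "n + d i \<le> l" for l
      proof (cases "l = n + d i")
        case True
        then show ?thesis using monic[OF i] by (simp add: coeff_monom_mult g_def y(2))
      next
        case False
        then have "coeff (f i) (l - n) = 0" using that by (intro coeff_eq_0) auto
        then show ?thesis using that False by (simp add: coeff_monom_mult g_def)
      qed
    qed
    moreover have "(monom y n * g i) \<bullet>\<bullet> v i = (\<Sum>j<i. (monom y n * h' i j) \<bullet>\<bullet> v j)"
      by (simp only: act_mult g_relation[OF i] act_sum_right)
    moreover have "(monom y n * h' i j) \<bullet>\<bullet> v j \<in> lattice n" if "j \<in> {..<i}" for j
    proof (rule lattice_single)
      show "gauss_norm (monom y n * h' i j) \<le> 1"
        using that y h'_integral[of j i] i by (intro gauss_norm_mult_le_1) (simp_all add: gauss_norm_monom)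
      show "coeff (monom y n * h' i j) l = 0" if "n + d j \<le> l" for l
        using that h'_reduced[of j i "l - n"] \<open>j \<in> {..<i}\<close> i by (simp add: coeff_monom_mult)
    qed (use that i in auto)
    ultimately have "(monom (\<xi> i) (n + d i) - monom y n * g i) \<bullet>\<bullet> v i
        + (monom y n * g i) \<bullet>\<bullet> v i \<in> lattice n"
      by (metis (no_types, lifting) lattice_add lattice_sum)
    then show "monom (\<xi> i) (n + d i) \<bullet>\<bullet> v i \<in> lattice n" by (simp flip: act_add)
  qed
qed

text \<open>
  By \<open>lead_mem_iff\<close> the quotient of consecutive lattices is the product of the rings \<open>O / c i O\<close>, of
  cardinality \<open>1 / |c i| = gauss_norm (f i)\<close>.
\<close>

lemma lattice_Suc_cosets:
  "\<exists>P. finite P \<and> real (card P) = (\<Prod>i<CARD('n). gauss_norm (f i)) \<and>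
     lattice (Suc n) = (\<Union>y\<in>P. (+) y ` lattice n) \<and> disjoint_family_on (\<lambda>y. (+) y ` lattice n) P"
proof -
  have "\<exists>R. finite R \<and> real (card R) = gauss_norm (f i) \<and> residue_system (c i) R" if i: "i < CARD('n)" for i
  proof -
    have "1 / padic_norm (c i) = gauss_norm (f i)" using c_norm[OF i] c_nz[OF i] by (simp add: field_simps)
    then show ?thesis using padic_residues[OF c_nz[OF i] c_le_1[OF i]] by simp
  qed
  then obtain R where R: "\<And>i. i < CARD('n) \<Longrightarrow> finite (R i)"
    "\<And>i. i < CARD('n) \<Longrightarrow> real (card (R i)) = gauss_norm (f i)"
    and rs: "\<And>i. i < CARD('n) \<Longrightarrow> residue_system (c i) (R i)"
    by metis
  have R1: "padic_norm r \<le> 1" if "i < CARD('n)" "r \<in> R i" for i r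
    using rs that by (simp add: residue_system_def)
  have R_approx: "\<exists>r\<in>R i. padic_norm (x - r) \<le> padic_norm (c i)"
    if "i < CARD('n)" "padic_norm x \<le> 1" for i x
    using rs that by (simp add: residue_system_def)
  have R_sep: "r = r'" if "i < CARD('n)" "r \<in> R i" "r' \<in> R i" "padic_norm (r - r') \<le> padic_norm (c i)" for i r r'
    using rs that by (simp add: residue_system_def)
  define Q where "Q = PiE {..<CARD('n)} R"
  have Q1: "padic_norm (r i) \<le> 1" if "r \<in> Q" "i < CARD('n)" for r i
    using that R1 by (auto simp: Q_def PiE_def)
  have diff1: "padic_norm (x - y) \<le> 1" if "padic_norm x \<le> 1" "padic_norm y \<le> 1" for x y :: "'p padic"
    using padic_norm_diff_le[of x y] that by simp
  have sep: "r = r'" if r: "r \<in> Q" "r' \<in> Q" and mem: "lead n r - lead n r' \<in> lattice n" for r r'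
  proof (rule PiE_ext)
    show "r \<in> PiE {..<CARD('n)} R" "r' \<in> PiE {..<CARD('n)} R" using r by (simp_all add: Q_def)
    fix i assume i: "i \<in> {..<CARD('n)}"
    have "\<forall>i<CARD('n). padic_norm (r i - r' i) \<le> padic_norm (c i)"
      using mem Q1 r by (subst lead_mem_iff[symmetric]) (auto simp: lead_diff diff1)
    then show "r i = r' i" using R_sep[of i "r i" "r' i"] r i by (auto simp: Q_def PiE_def)
  qed
  have inj: "inj_on (lead n) Q" using sep by (intro inj_onI) auto
  have finQ: "finite Q" unfolding Q_def using R(1) by (intro finite_PiE) auto
  have "real (card (lead n ` Q)) = (\<Prod>i<CARD('n). gauss_norm (f i))"
    by (subst card_image[OF inj]) (simp add: Q_def card_PiE R(2))
  moreover have "lattice (Suc n) = (\<Union>y\<in>lead n ` Q. (+) y ` lattice n)"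
  proof (intro equalityI subsetI)
    fix x assume "x \<in> lattice (Suc n)"
    then obtain y \<xi> where x: "y \<in> lattice n" "\<And>i. i < CARD('n) \<Longrightarrow> padic_norm (\<xi> i) \<le> 1" "x = y + lead n \<xi>"
      by (rule lattice_Suc_split) blast
    define r where "r i = (SOME r. r \<in> R i \<and> padic_norm (\<xi> i - r) \<le> padic_norm (c i))" for i
    have r: "r i \<in> R i \<and> padic_norm (\<xi> i - r i) \<le> padic_norm (c i)" if "i < CARD('n)" for i
    proof -
      have "\<exists>r. r \<in> R i \<and> padic_norm (\<xi> i - r) \<le> padic_norm (c i)"
        using R_approx[OF that x(2)[OF that]] by blast
      from someI_ex[OF this] show ?thesis by (simp only: r_def)
    qed
    define r' where "r' = restrict r {..<CARD('n)}"
    have r': "r' \<in> Q" using r by (auto simp: r'_def Q_def)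
    have "lead n \<xi> - lead n r' \<in> lattice n"
      unfolding lead_diff using r by (subst lead_mem_iff) (auto simp: r'_def intro: diff1 x(2) R1)
    then have "y + (lead n \<xi> - lead n r') \<in> lattice n" using x(1) by (intro lattice_add)
    moreover have "x = lead n r' + (y + (lead n \<xi> - lead n r'))" by (simp add: x(3))
    ultimately show "x \<in> (\<Union>y\<in>lead n ` Q. (+) y ` lattice n)" using r' by blast
  next
    fix x assume "x \<in> (\<Union>y\<in>lead n ` Q. (+) y ` lattice n)"
    then obtain r y where "r \<in> Q" "y \<in> lattice n" "x = lead n r + y" by auto
    then show "x \<in> lattice (Suc n)"
      using lead_mem_Suc[of r n] Q1 lattice_mono[of n "Suc n"] by (auto intro!: lattice_add)
  qed
  moreover have "disjoint_family_on (\<lambda>y. (+) y ` lattice n) (lead n ` Q)"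
    unfolding disjoint_family_on_def
  proof (intro ballI impI)
    fix a b assume ab: "a \<in> lead n ` Q" "b \<in> lead n ` Q" "a \<noteq> b"
    show "(+) a ` lattice n \<inter> (+) b ` lattice n = {}"
    proof (rule ccontr)
      assume "(+) a ` lattice n \<inter> (+) b ` lattice n \<noteq> {}"
      then obtain x y where "x \<in> lattice n" "y \<in> lattice n" "a + x = b + y" by blast
      moreover from this have "a - b = y - x" by (simp add: algebra_simps)
      ultimately have "a - b \<in> lattice n" by (simp add: lattice_diff)
      then show False using ab sep by auto
    qed
  qed
  ultimately show ?thesis using finQ by (intro exI[of _ "lead n ` Q"]) simp
qed

text \<open>
  The \<open>n\<close>-th image of \<open>lattice 1\<close> contains the new powers of \<open>T\<close> applied to every \<open>v i\<close>. With
  \<open>lattice 0\<close> as the start those with \<open>f i = 1\<close> would be missing among the given generators.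
\<close>

lemma trajectory_lattice: "trajectory T (lattice 1) (Suc n) = lattice (Suc n)"
proof (induction n)
  case 0
  show ?case by (simp add: trajectory_def)
next
  case (Suc n)
  have pow: "(T ^^ k) w = monom 1 k \<bullet>\<bullet> w" for k w by (simp add: act_monom)
  have "trajectory T (lattice 1) (Suc (Suc n)) = lattice (Suc n) + (T ^^ Suc n) ` lattice 1"
    using Suc.IH by (simp add: trajectory_def)
  also have "\<dots> = lattice (Suc (Suc n))"
  proof (intro equalityI subsetI)
    fix x assume "x \<in> lattice (Suc n) + (T ^^ Suc n) ` lattice 1"
    then obtain y z where x: "x = y + monom 1 (Suc n) \<bullet>\<bullet> z" "y \<in> lattice (Suc n)" "z \<in> lattice 1"
      unfolding pow by (elim set_plus_elim) blast
    obtain u where u: "z = (\<Sum>i<CARD('n). u i \<bullet>\<bullet> v i)" "\<And>i. i < CARD('n) \<Longrightarrow> gauss_norm (u i) \<le> 1"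
      "\<And>i l. i < CARD('n) \<Longrightarrow> 1 + d i \<le> l \<Longrightarrow> coeff (u i) l = 0" by (rule lattice_E[OF x(3)]) blast
    have "(\<Sum>i<CARD('n). (monom 1 (Suc n) * u i) \<bullet>\<bullet> v i) \<in> lattice (Suc (Suc n))"
      using u(2,3) by (intro lattice_I gauss_norm_mult_le_1) (auto simp: gauss_norm_monom coeff_monom_mult)
    then have "monom 1 (Suc n) \<bullet>\<bullet> z \<in> lattice (Suc (Suc n))" by (simp add: u(1) act_sum_right act_mult)
    then show "x \<in> lattice (Suc (Suc n))" using x lattice_mono[of "Suc n" "Suc (Suc n)"] by (auto intro: lattice_add)
  next
    fix x assume "x \<in> lattice (Suc (Suc n))"
    then obtain y \<xi> where x: "y \<in> lattice (Suc n)" "\<And>i. i < CARD('n) \<Longrightarrow> padic_norm (\<xi> i) \<le> 1" "x = y + lead (Suc n) \<xi>"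
      by (rule lattice_Suc_split) blast
    have "lead (Suc n) \<xi> = monom 1 (Suc n) \<bullet>\<bullet> lead 0 \<xi>"
      by (simp add: lead_def act_sum_right mult_monom flip: act_mult)
    moreover have "lead 0 \<xi> \<in> lattice 1" using lead_mem_Suc[of \<xi> 0] x(2) by simp
    ultimately show "x \<in> lattice (Suc n) + (T ^^ Suc n) ` lattice 1" unfolding pow using x(1,3) by blast
  qed
  finally show ?case .
qed

lemma lattice_contains_box:
  assumes "\<And>i. i < CARD('n) \<Longrightarrow> padic_norm (x $ \<sigma> i) \<le> padic_norm (t i)"
  shows "x \<in> lattice (Suc n)"
proof -
  have "x = (\<Sum>a\<in>UNIV. x $ a *s axis a 1)" by (simp add: basis_expansion)
  also have "\<dots> = (\<Sum>i<CARD('n). x $ \<sigma> i *s axis (\<sigma> i) 1)"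
    using sum.reindex_bij_betw[OF bij, of "\<lambda>a. x $ a *s axis a 1"] by simp
  also have "\<dots> = (\<Sum>i<CARD('n). [:x $ \<sigma> i / t i:] \<bullet>\<bullet> v i)"
    using t_nz by (intro sum.cong) (auto simp: v_def)
  also have "\<dots> \<in> lattice (Suc n)"
  proof (rule lattice_I)
    fix i assume i: "i < CARD('n)"
    then show "gauss_norm [:x $ \<sigma> i / t i:] \<le> 1"
      using assms[OF i] t_nz[OF i] by (simp add: gauss_norm_def padic_norm_divide divide_le_eq order_less_le)
  qed (auto simp: coeff_eq_0)
  finally show ?thesis .
qed

lemma lattice_bounded: "\<exists>B. \<forall>x\<in>lattice n. \<forall>a. padic_norm (x $ a) \<le> B"
proof (intro exI ballI allI)
  fix x a assume "x \<in> lattice n"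
  then obtain u where u: "x = (\<Sum>i<CARD('n). u i \<bullet>\<bullet> v i)" "\<And>i. i < CARD('n) \<Longrightarrow> gauss_norm (u i) \<le> 1"
    "\<And>i l. i < CARD('n) \<Longrightarrow> n + d i \<le> l \<Longrightarrow> coeff (u i) l = 0" by (rule lattice_E) blast
  let ?b = "\<lambda>i l. \<Sum>a\<in>UNIV. padic_norm ((T ^^ l) (v i) $ a)"
  let ?B = "\<Sum>i<CARD('n). \<Sum>l<n + d i. ?b i l"
  have x: "x $ a = (\<Sum>i<CARD('n). \<Sum>l<n + d i. coeff (u i) l * (T ^^ l) (v i) $ a)"
    unfolding u(1) sum_component
  proof (rule sum.cong[OF refl])
    fix i assume "i \<in> {..<CARD('n)}"
    then have "u i \<bullet>\<bullet> v i = (\<Sum>l<n + d i. coeff (u i) l *s (T ^^ l) (v i))"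
      using u(3) by (intro act_eq_sum) simp
    then show "(u i \<bullet>\<bullet> v i) $ a = (\<Sum>l<n + d i. coeff (u i) l * (T ^^ l) (v i) $ a)"
      by (simp add: sum_component)
  qed
  show "padic_norm (x $ a) \<le> ?B"
    unfolding x
  proof (intro padic_norm_sum_le)
    fix i l assume i: "i \<in> {..<CARD('n)}" and l: "l \<in> {..<n + d i}"
    have "padic_norm (coeff (u i) l * (T ^^ l) (v i) $ a) \<le> padic_norm ((T ^^ l) (v i) $ a)"
      using u(2)[of i] coeff_le_gauss_norm[of "u i" l] i by (simp add: padic_norm_mult mult_left_le_one_le)
    also have "\<dots> \<le> ?b i l" by (rule member_le_sum) auto
    also have "\<dots> \<le> (\<Sum>l<n + d i. ?b i l)" by (rule member_le_sum) (use l in \<open>auto intro: sum_nonneg\<close>)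
    also have "\<dots> \<le> ?B"
      by (rule member_le_sum[where f = "\<lambda>i. \<Sum>l<n + d i. ?b i l"]) (use i in \<open>auto intro!: sum_nonneg\<close>)
    finally show "padic_norm (coeff (u i) l * (T ^^ l) (v i) $ a) \<le> ?B" .
  qed (auto intro!: sum_nonneg)
qed

end

section \<open>Haar measure and entropy\<close>

lemma open_vecI:
  fixes S :: "('p::prime_card padic ^ 'n) set"
  assumes e: "e > 0" and S: "\<And>y z. y \<in> S \<Longrightarrow> (\<And>a. padic_norm ((z - y) $ a) < e) \<Longrightarrow> z \<in> S"
  shows "open S"
  unfolding open_dist
proof (intro ballI exI conjI allI impI)
  fix y z assume "y \<in> S" and d: "dist z y < e"
  show "z \<in> S"
  proof (rule S[OF \<open>y \<in> S\<close>])
    fix a show "padic_norm ((z - y) $ a) < e"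
      using dist_vec_nth_le[of z a y] d by (simp add: dist_padic_def)
  qed
qed (rule e)

lemma bounded_vec_iff:
  fixes S :: "('p::prime_card padic ^ 'n) set"
  shows "bounded S \<longleftrightarrow> (\<exists>B. \<forall>x\<in>S. \<forall>a. padic_norm (x $ a) \<le> B)"
proof
  assume "bounded S"
  then obtain B where B: "\<forall>x\<in>S. dist 0 x \<le> B" by (auto simp: bounded_any_center[of _ 0])
  have "padic_norm (x $ a) \<le> B" if "x \<in> S" for x a
    using dist_vec_nth_le[of 0 a x] B that by (force simp: dist_padic_def)
  then show "\<exists>B. \<forall>x\<in>S. \<forall>a. padic_norm (x $ a) \<le> B" by blast
next
  assume "\<exists>B. \<forall>x\<in>S. \<forall>a. padic_norm (x $ a) \<le> B"
  then obtain B where B: "\<And>x a. x \<in> S \<Longrightarrow> padic_norm (x $ a) \<le> B" by blast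
  have "dist 0 x \<le> (\<Sum>a\<in>(UNIV::'n set). B)" if "x \<in> S" for x
  proof -
    have "dist 0 x \<le> (\<Sum>a\<in>UNIV. dist (0 $ a) (x $ a))"
      unfolding dist_vec_def by (rule L2_set_le_sum) simp
    also have "\<dots> \<le> (\<Sum>a\<in>(UNIV::'n set). B)"
      using B[OF that] by (intro sum_mono) (simp add: dist_padic_def)
    finally show ?thesis .
  qed
  then show "bounded S" unfolding bounded_def by blast
qed

context integral_flag
begin

lemma lattice_small_coords: "\<exists>e>0. \<forall>x n. (\<forall>a. padic_norm (x $ a) < e) \<longrightarrow> x \<in> lattice (Suc n)"
proof -
  define e where "e = Min ((\<lambda>i. padic_norm (t i)) ` {..<CARD('n)})"
  have ne: "(\<lambda>i. padic_norm (t i)) ` {..<CARD('n)} \<noteq> {}" by (simp add: lessThan_empty_iff)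
  have "e > 0" unfolding e_def using ne t_nz by (subst Min_gr_iff) (auto simp: order_less_le)
  moreover have le: "e \<le> padic_norm (t i)" if "i < CARD('n)" for i
    unfolding e_def using that by (intro Min_le) auto
  have "x \<in> lattice (Suc n)" if x: "\<forall>a. padic_norm (x $ a) < e" for x n
  proof (rule lattice_contains_box)
    fix i assume "i < CARD('n)"
    then show "padic_norm (x $ \<sigma> i) \<le> padic_norm (t i)" using x[rule_format, of "\<sigma> i"] le[of i] by linarith
  qed
  ultimately show ?thesis by blast
qed

lemma open_coset: "open ((+) x ` lattice (Suc n))"
proof -
  obtain e where e: "e > 0" "\<And>x n. (\<forall>a. padic_norm (x $ a) < e) \<longrightarrow> x \<in> lattice (Suc n)"
    using lattice_small_coords by blast
  show ?thesis
  proof (rule open_vecI[OF e(1)])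
    fix y z assume y: "y \<in> (+) x ` lattice (Suc n)" and z: "\<And>a. padic_norm ((z - y) $ a) < e"
    obtain w where w: "w \<in> lattice (Suc n)" "y = x + w" using y by blast
    have "z - y \<in> lattice (Suc n)" using e(2) z by blast
    then have "w + (z - y) \<in> lattice (Suc n)" using w(1) by (rule lattice_add[rotated])
    moreover have "z = x + (w + (z - y))" by (simp add: w(2))
    ultimately show "z \<in> (+) x ` lattice (Suc n)" by blast
  qed
qed

lemma open_lattice: "open (lattice (Suc n))"
  using open_coset[of 0 n] by simp

lemma compact_lattice: "compact (lattice (Suc n))"
proof -
  obtain e where e: "e > 0" "\<And>x n. (\<forall>a. padic_norm (x $ a) < e) \<longrightarrow> x \<in> lattice (Suc n)"
    using lattice_small_coords by blast
  have "open (- lattice (Suc n))"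
  proof (rule open_vecI[OF e(1)])
    fix y z assume y: "y \<in> - lattice (Suc n)" and z: "\<And>a. padic_norm ((z - y) $ a) < e"
    have "z - y \<in> lattice (Suc n)" using e(2) z by blast
    then have "z \<notin> lattice (Suc n)" using y lattice_diff[of z "Suc n" "z - y"] by auto
    then show "z \<in> - lattice (Suc n)" by simp
  qed
  then have "closed (lattice (Suc n))" by (simp add: closed_def)
  moreover have "bounded (lattice (Suc n))" unfolding bounded_vec_iff using lattice_bounded by blast
  ultimately show ?thesis by (simp add: compact_eq_bounded_closed)
qed

context
  fixes M :: "('p padic ^ 'n) measure" assumes haar: "haar_measure M"
begin

lemma open_in_sets: "open U \<Longrightarrow> U \<in> sets M"
  using haar by (simp add: haar_measure_def)

lemma emeasure_coset: "emeasure M ((+) x ` lattice (Suc n)) = emeasure M (lattice (Suc n))"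
  using haar open_in_sets[OF open_lattice] by (simp add: haar_measure_def)

lemma emeasure_lattice_finite: "emeasure M (lattice (Suc n)) < \<infinity>"
  using haar compact_lattice by (simp add: haar_measure_def)

lemma measure_lattice_step:
  "measure M (lattice (Suc (Suc n))) = (\<Prod>i<CARD('n). gauss_norm (f i)) * measure M (lattice (Suc n))"
proof -
  obtain P where P: "finite P" "real (card P) = (\<Prod>i<CARD('n). gauss_norm (f i))"
    "lattice (Suc (Suc n)) = (\<Union>y\<in>P. (+) y ` lattice (Suc n))"
    "disjoint_family_on (\<lambda>y. (+) y ` lattice (Suc n)) P"
    using lattice_Suc_cosets[of "Suc n"] by blast
  have "emeasure M (lattice (Suc (Suc n))) = (\<Sum>y\<in>P. emeasure M ((+) y ` lattice (Suc n)))"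
    unfolding P(3) using P(1,4) by (intro sum_emeasure[symmetric]) (auto intro: open_in_sets open_coset)
  also have "\<dots> = of_nat (card P) * emeasure M (lattice (Suc n))"
    by (simp add: emeasure_coset)
  finally have "measure M (lattice (Suc (Suc n))) = real (card P) * measure M (lattice (Suc n))"
    by (simp add: measure_def enn2real_mult)
  then show ?thesis by (simp add: P(2))
qed

lemma measure_lattice: "measure M (lattice (Suc n)) = (\<Prod>i<CARD('n). gauss_norm (f i)) ^ n * measure M (lattice 1)"
  by (induction n) (simp_all add: measure_lattice_step)

text \<open>
  A lattice is open, so finitely many translates cover any compact set; were it a null set, all
  compact sets would be, and by inner regularity the whole space.
\<close>

lemma measure_lattice_pos: "measure M (lattice (Suc n)) > 0"
proof -
  have "emeasure M (lattice (Suc n)) \<noteq> 0"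
  proof
    assume 0: "emeasure M (lattice (Suc n)) = 0"
    have "emeasure M K = 0" if K: "compact K" for K
    proof -
      have "K \<subseteq> (\<Union>x\<in>K. (+) x ` lattice (Suc n))" by (force intro: image_eqI[of _ _ 0])
      then obtain F where F: "F \<subseteq> K" "finite F" "K \<subseteq> (\<Union>x\<in>F. (+) x ` lattice (Suc n))"
        using compactE_image[OF K, of K "\<lambda>x. (+) x ` lattice (Suc n)"] open_coset by metis
      have "emeasure M K \<le> emeasure M (\<Union>x\<in>F. (+) x ` lattice (Suc n))"
        using F by (intro emeasure_mono open_in_sets open_UN) (auto intro: open_coset)
      also have "\<dots> \<le> (\<Sum>x\<in>F. emeasure M ((+) x ` lattice (Suc n)))"
        using F by (intro emeasure_subadditive_finite) (auto intro: open_in_sets open_coset)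
      also have "\<dots> = 0" by (simp add: emeasure_coset 0)
      finally show ?thesis by simp
    qed
    then have "(SUP K\<in>{K. compact K \<and> K \<subseteq> UNIV}. emeasure M K) = 0"
      by (intro antisym SUP_least) auto
    moreover have "emeasure M UNIV = (SUP K\<in>{K. compact K \<and> K \<subseteq> UNIV}. emeasure M K)"
      and "emeasure M UNIV \<noteq> 0"
      using haar open_UNIV unfolding haar_measure_def by blast+
    ultimately show False by simp
  qed
  then show ?thesis using emeasure_lattice_finite[of n] by (simp add: measure_def enn2real_positive_iff zero_less_iff_neq_zero)
qed

end

end

text \<open>
  The scaling factors are chosen one after the other. Multiplying all of them by the same scalar
  preserves the assumptions, which allows the bound \<open>r\<close>, and with it the lattices, to be as large as
  desired.
\<close>

lemma exists_integral_flag: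
  fixes A :: "'p::prime_card padic ^ 'n ^ 'n"
  shows "\<exists>\<sigma> f h t c. integral_flag ((*v) A) \<sigma> f h t c \<and> (\<forall>i<CARD('n). r \<le> padic_norm (t i))"
proof -
  interpret vec_endo "(*v) A"
    by unfold_locales (simp_all add: matrix_vector_right_distrib vector_scalar_commute)
  obtain \<sigma> :: "nat \<Rightarrow> 'n" where \<sigma>: "bij_betw \<sigma> {..<CARD('n)} UNIV"
    using ex_bij_betw_nat_finite[of "UNIV :: 'n set"] by (auto simp: atLeast0LessThan)
  obtain f h where "cyclic_flag ((*v) A) CARD('n) (\<lambda>i. axis (\<sigma> i) 1) f h"
    using exists_cyclic_flag[of "CARD('n)" "\<lambda>i. axis (\<sigma> i) 1"] by (elim exE)
  then interpret cyclic_flag "(*v) A" "CARD('n)" "\<lambda>i. axis (\<sigma> i) 1" f h .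
  have ts: "\<exists>t :: nat \<Rightarrow> 'p padic. \<forall>i<n. t i \<noteq> 0 \<and> (\<forall>j<i. padic_norm (t i) * gauss_norm (h i j) \<le> padic_norm (t j))" for n
  proof (induction n)
    case (Suc n)
    then obtain t :: "nat \<Rightarrow> 'p padic" where t: "\<And>i. i < n \<Longrightarrow> t i \<noteq> 0"
      "\<And>i j. i < n \<Longrightarrow> j < i \<Longrightarrow> padic_norm (t i) * gauss_norm (h i j) \<le> padic_norm (t j)" by blast
    define b where "b j = padic_norm (t j) / (1 + gauss_norm (h n j))" for j
    define e where "e = Min (insert 1 (b ` {..<n}))"
    have den: "1 + gauss_norm (h n j) > 0" for j using gauss_norm_nonneg[of "h n j"] by linarith
    have "e > 0" unfolding e_def
      using t(1) den by (subst Min_gr_iff) (auto simp: b_def order_less_le intro!: divide_pos_pos)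
    then obtain s :: "'p padic" where s: "s \<noteq> 0" "padic_norm s \<le> e" using padic_norm_small by blast
    have "padic_norm s * gauss_norm (h n j) \<le> padic_norm (t j)" if "j < n" for j
    proof -
      have "padic_norm s * gauss_norm (h n j) \<le> b j * (1 + gauss_norm (h n j))"
      proof (intro mult_mono)
        have "e \<le> b j" unfolding e_def using that by (intro Min_le) auto
        then show "padic_norm s \<le> b j" using s(2) by simp
        show "0 \<le> b j" by (simp add: b_def)
      qed auto
      also have "\<dots> = padic_norm (t j)" using den[of j] by (simp add: b_def)
      finally show ?thesis .
    qed
    then show ?case using s t by (intro exI[of _ "t(n := s)"]) (auto simp: less_Suc_eq)
  qed simp
  obtain t :: "nat \<Rightarrow> 'p padic" where t: "\<And>i. i < CARD('n) \<Longrightarrow> t i \<noteq> 0"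
    "\<And>i j. i < CARD('n) \<Longrightarrow> j < i \<Longrightarrow> padic_norm (t i) * gauss_norm (h i j) \<le> padic_norm (t j)" using ts[of "CARD('n)"] by auto
  have "\<exists>c :: 'p padic. padic_norm c * gauss_norm (f i) = 1" if "i < CARD('n)" for i
  proof -
    obtain k where k: "padic_norm (coeff (f i) k) = gauss_norm (f i)" using gauss_norm_attained by blast
    have "f i \<noteq> 0" using monic[OF that] by auto
    \<comment> \<open>the inverse of a coefficient of maximal norm\<close>
    then show ?thesis using k by (intro exI[of _ "inverse (coeff (f i) k)"]) (simp add: padic_norm_inverse)
  qed
  then obtain c :: "nat \<Rightarrow> 'p padic" where c: "\<And>i. i < CARD('n) \<Longrightarrow> padic_norm (c i) * gauss_norm (f i) = 1" by metis
  have "\<exists>z :: 'p padic. z \<noteq> 0 \<and> (\<forall>i<CARD('n). r \<le> padic_norm (z * t i))"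
  proof -
    define m where "m = Min ((\<lambda>i. padic_norm (t i)) ` {..<CARD('n)})"
    have "m > 0" unfolding m_def
      using t(1) by (subst Min_gr_iff) (auto simp: order_less_le lessThan_empty_iff)
    have m: "m \<le> padic_norm (t i)" if "i < CARD('n)" for i
      unfolding m_def using that by (intro Min_le) auto
    have "m / max 1 r > 0" using \<open>m > 0\<close> by simp
    then obtain y :: "'p padic" where y: "y \<noteq> 0" "padic_norm y \<le> m / max 1 r"
      using padic_norm_small by blast
    have "r \<le> padic_norm (inverse y * t i)" if "i < CARD('n)" for i
    proof -
      have "padic_norm y > 0" using y(1) by (simp add: order_less_le)
      moreover have "padic_norm y * max 1 r \<le> padic_norm (t i)"
        using y(2) m[OF that] by (simp add: pos_le_divide_eq)
      moreover have "padic_norm y * r \<le> padic_norm y * max 1 r" by (intro mult_left_mono) auto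
      ultimately have "padic_norm y > 0" "padic_norm y * r \<le> padic_norm (t i)" by linarith+
      then show ?thesis
        by (simp add: padic_norm_divide pos_le_divide_eq mult.commute flip: divide_inverse_commute)
    qed
    then show ?thesis using y(1) by (intro exI[of _ "inverse y"]) simp
  qed
  then obtain z :: "'p padic" where z: "z \<noteq> 0" "\<forall>i<CARD('n). r \<le> padic_norm (z * t i)" by blast
  have "integral_flag ((*v) A) \<sigma> f h (\<lambda>i. z * t i) c"
    by unfold_locales (use \<sigma> t c z(1) in \<open>auto simp: padic_norm_mult mult.assoc intro: mult_left_mono\<close>)
  then show ?thesis using z(2) by (intro exI conjI)
qed

lemma trajectory_mono: "C \<subseteq> C' \<Longrightarrow> trajectory F C n \<subseteq> trajectory F C' n"
  unfolding trajectory_def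
  by (induction n) (simp_all add: set_plus_mono2 image_mono)

text \<open>
  The growth factor does not depend on \<open>B\<close>: it is the Gauss norm of the characteristic polynomial
  for every choice of the flag.
\<close>

lemma exists_growth_neighbourhood:
  fixes A :: "'p::prime_card padic ^ 'n ^ 'n"
  assumes haar: "haar_measure M"
  shows "\<exists>C\<in>compact_nhds_0. (\<forall>x. (\<forall>a. padic_norm (x $ a) \<le> B) \<longrightarrow> x \<in> C) \<and> 0 < measure M C \<and>
    (\<forall>n. compact (trajectory ((*v) A) C (Suc n)) \<and>
      measure M (trajectory ((*v) A) C (Suc n)) = gauss_norm (charpoly A) ^ n * measure M C)"
proof -
  obtain \<sigma> f h t c where fl: "integral_flag ((*v) A) \<sigma> f h t c" and B: "\<forall>i<CARD('n). B \<le> padic_norm (t i)"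
    using exists_integral_flag[of A B] by (elim exE conjE)
  interpret integral_flag "(*v) A" \<sigma> f h t c by (rule fl)
  have a: "(\<Prod>i<CARD('n). gauss_norm (f i)) = gauss_norm (charpoly A)"
    using charpoly_eq_prod_flag[OF bij cyclic_flag_axioms] by (simp add: gauss_norm_prod)
  have traj: "trajectory ((*v) A) (lattice 1) (Suc n) = lattice (Suc n)" for n by (rule trajectory_lattice)
  show ?thesis
  proof (intro bexI[of _ "lattice 1"] conjI allI impI)
    show "x \<in> lattice 1" if "\<forall>a. padic_norm (x $ a) \<le> B" for x
      using lattice_contains_box[of x 0] that B order_trans by fastforce
    show "0 < measure M (lattice 1)" using measure_lattice_pos[OF haar, of 0] by simp
    show "measure M (trajectory ((*v) A) (lattice 1) (Suc n)) = gauss_norm (charpoly A) ^ n * measure M (lattice 1)" for n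
      unfolding traj using measure_lattice[OF haar, of n] by (simp add: a)
    show "compact (trajectory ((*v) A) (lattice 1) (Suc n))" for n unfolding traj by (rule compact_lattice)
    show "lattice 1 \<in> compact_nhds_0"
      using compact_lattice[of 0] interior_open[OF open_lattice[of 0]] by (simp add: compact_nhds_0_def)
  qed
qed

lemma affine_over_n_tendsto:
  "(\<lambda>n. ereal ((real (n - 1) * L + K) / real n)) \<longlonglongrightarrow> ereal L"
proof -
  have "(\<lambda>n. L + (K - L) / real n) \<longlonglongrightarrow> L + 0"
    by (intro tendsto_add tendsto_const lim_const_over_n)
  moreover have ev: "\<forall>\<^sub>F n in sequentially. L + (K - L) / real n = (real (n - 1) * L + K) / real n"
    using eventually_gt_at_top[of 0]
    by eventually_elim (simp add: field_simps of_nat_diff)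
  ultimately have "(\<lambda>n. (real (n - 1) * L + K) / real n) \<longlonglongrightarrow> L + 0"
    by (rule Lim_transform_eventually)
  then show ?thesis by simp
qed

text \<open>
  Every compact neighbourhood lies in one of the lattices above, which bounds its entropy; the
  lattices themselves attain the bound.
\<close>

theorem alg_entropy_matrix:
  fixes A :: "'p::prime_card padic ^ 'n ^ 'n"
  assumes haar: "haar_measure M"
  shows "alg_entropy M ((*v) A) = ereal (ln (gauss_norm (charpoly A)))"
proof -
  let ?a = "gauss_norm (charpoly A)" and ?T = "trajectory ((*v) A)"
  have a: "?a \<ge> 1" using charpoly_degree_coeff(2)[of A] by (rule gauss_norm_monic_ge_1)
  show ?thesis
    unfolding alg_entropy_def
  proof (rule antisym)
    show "(SUP C\<in>compact_nhds_0. alg_entropy_at M ((*v) A) C) \<le> ereal (ln ?a)"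
    proof (rule SUP_least)
      fix C :: "('p padic ^ 'n) set" assume C: "C \<in> compact_nhds_0"
      then have "bounded C" by (simp add: compact_nhds_0_def compact_imp_bounded)
      then obtain B where B: "\<forall>x\<in>C. \<forall>a. padic_norm (x $ a) \<le> B" unfolding bounded_vec_iff by blast
      obtain C' where C': "\<forall>x. (\<forall>a. padic_norm (x $ a) \<le> B) \<longrightarrow> x \<in> C'" "0 < measure M C'"
        "\<And>n. compact (?T C' (Suc n))" "\<And>n. measure M (?T C' (Suc n)) = ?a ^ n * measure M C'"
        using exists_growth_neighbourhood[OF haar, of B A] by blast
      have "C \<subseteq> C'" using B C'(1) by blast
      have le: "ln (measure M (?T C n)) \<le> real (n - 1) * ln ?a + \<bar>ln (measure M C')\<bar>" if n: "n > 0" for n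
      proof (cases "measure M (?T C n) = 0")
        case True
        then show ?thesis using a by simp
      next
        case False
        obtain k where k: "n = Suc k" using n by (cases n) auto
        have "?T C' n \<in> sets M" and fin: "emeasure M (?T C' n) < \<infinity>"
          using haar C'(3)[of k] by (auto simp: haar_measure_def k compact_imp_closed)
        then have "emeasure M (?T C n) \<le> emeasure M (?T C' n)"
          using trajectory_mono[OF \<open>C \<subseteq> C'\<close>] by (intro emeasure_mono)
        then have "measure M (?T C n) \<le> measure M (?T C' n)"
          unfolding measure_def using fin by (intro enn2real_mono) auto
        moreover have "measure M (?T C n) > 0" using False by (simp add: order_less_le)
        ultimately have "ln (measure M (?T C n)) \<le> ln (?a ^ k * measure M C')"
          using C'(4)[of k] by (simp add: k)
        also have "\<dots> = real k * ln ?a + ln (measure M C')"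
          using a C'(2) by (subst ln_mult) (auto simp: ln_realpow)
        finally show ?thesis by (simp add: k)
      qed
      have "alg_entropy_at M ((*v) A) C
          \<le> limsup (\<lambda>n. ereal ((real (n - 1) * ln ?a + \<bar>ln (measure M C')\<bar>) / real n))"
        unfolding alg_entropy_at_def
      proof (rule Limsup_mono)
        show "\<forall>\<^sub>F n in sequentially. ereal (ln (measure M (?T C n)) / real n)
          \<le> ereal ((real (n - 1) * ln ?a + \<bar>ln (measure M C')\<bar>) / real n)"
          using eventually_gt_at_top[of 0]
          by eventually_elim (use le in \<open>auto intro: divide_right_mono\<close>)
      qed
      also have "\<dots> = ereal (ln ?a)"
        by (rule lim_imp_Limsup[OF _ affine_over_n_tendsto]) simp
      finally show "alg_entropy_at M ((*v) A) C \<le> ereal (ln ?a)" .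
    qed
    obtain C :: "('p padic ^ 'n) set" where C: "C \<in> compact_nhds_0" "0 < measure M C"
      "\<And>n. measure M (?T C (Suc n)) = ?a ^ n * measure M C"
      using exists_growth_neighbourhood[OF haar, of 0 A] by blast
    have eq: "ln (measure M (?T C n)) = real (n - 1) * ln ?a + ln (measure M C)" if n: "n > 0" for n
    proof -
      obtain k where k: "n = Suc k" using n by (cases n) auto
      show ?thesis using a C(2) by (simp add: k C(3), subst ln_mult) (auto simp: ln_realpow)
    qed
    have "alg_entropy_at M ((*v) A) C
        = limsup (\<lambda>n. ereal ((real (n - 1) * ln ?a + ln (measure M C)) / real n))"
      unfolding alg_entropy_at_def
    proof (rule Limsup_eq)
      show "\<forall>\<^sub>F n in sequentially. ereal (ln (measure M (?T C n)) / real n)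
        = ereal ((real (n - 1) * ln ?a + ln (measure M C)) / real n)"
        using eventually_gt_at_top[of 0] by eventually_elim (simp add: eq)
    qed
    also have "\<dots> = ereal (ln ?a)"
      by (rule lim_imp_Limsup[OF _ affine_over_n_tendsto]) simp
    finally show "ereal (ln ?a) \<le> (SUP C\<in>compact_nhds_0. alg_entropy_at M ((*v) A) C)"
      using C(1) by (intro SUP_upper2[of C]) auto
  qed
qed

section \<open>The integral characteristic polynomial\<close>

lemma charpoly_of_rat:
  fixes A :: "rat ^ 'n ^ 'n"
  shows "charpoly (map_matrix of_rat A :: 'a::field_char_0 ^ 'n ^ 'n) = map_poly of_rat (charpoly A)"
proof -
  interpret of_rat: comm_ring_hom "of_rat :: rat \<Rightarrow> 'a"
    by unfold_locales (simp_all add: of_rat_add of_rat_mult)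
  interpret map_of_rat: map_poly_comm_ring_hom "of_rat :: rat \<Rightarrow> 'a" ..
  have entry: "(mat [:0, 1:] - map_matrix (\<lambda>a. [:a:]) (map_matrix of_rat A)) $ i $ j
     = map_poly (of_rat :: rat \<Rightarrow> 'a) ((mat [:0, 1:] - map_matrix (\<lambda>a. [:a:]) A) $ i $ j)" for i j
    by (simp add: mat_def poly_eq_iff coeff_map_poly coeff_pCons of_rat_diff split: nat.split)
  show ?thesis
    unfolding charpoly_def det_def by (simp only: entry hom_distribs)
qed

lemma exists_integer_multiple:
  fixes f :: "rat poly"
  shows "\<exists>s>0. \<exists>g. map_poly of_int g = smult (of_nat s) f"
proof (induction f)
  case 0
  show ?case by (rule exI[of _ 1]) (auto intro!: exI[of _ 0])
next
  case (pCons a f)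
  then obtain s g where s: "s > 0" and g: "map_poly of_int g = smult (of_nat s) f" by blast
  obtain x y where xy: "a = of_int x / of_int y" "y > 0"
    by (metis quotient_of_denom_pos quotient_of_div surj_pair)
  have "map_poly of_int (pCons (x * int s) (smult y g)) = smult (of_nat (s * nat y)) (pCons a f)"
  proof (rule poly_eqI)
    fix l
    show "coeff (map_poly of_int (pCons (x * int s) (smult y g))) l
        = coeff (smult (of_nat (s * nat y)) (pCons a f)) l"
      using arg_cong[OF g, of "\<lambda>p. coeff p (l - 1)"] xy
      by (cases l) (simp_all add: coeff_map_poly field_simps)
  qed
  then show ?case using s xy(2) by (intro exI[of _ "s * nat y"] conjI exI) auto
qed

lemma padic_norm_of_int_eq_1:
  "\<not> int CARD('p) dvd a \<Longrightarrow> padic_norm (of_int a :: 'p::prime_card padic) = 1"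
  using padic_norm_of_int[of a, where 'p='p] by (cases "a = 0") (simp_all add: not_dvd_imp_multiplicity_0)

text \<open>
  Let \<open>d\<close> be the denominator. The coefficients of \<open>d f\<close> are integers. If \<open>p\<close> divided all of them, it
  would divide the leading one, which is \<open>d\<close> itself, and \<open>d / p\<close> would be a smaller denominator.
\<close>

lemma gauss_norm_poly_denom:
  fixes f :: "rat poly"
  assumes monic: "lead_coeff f = 1"
  shows "padic_norm (of_nat (poly_denom f) :: 'p::prime_card padic)
    * gauss_norm (map_poly of_rat f :: 'p padic poly) = 1"
proof -
  let ?d = "poly_denom f" and ?p = "CARD('p)"
  have "?d > 0 \<and> (\<exists>g. map_poly of_int g = smult (of_nat ?d) f)"
    unfolding poly_denom_def by (rule LeastI_ex) (rule exists_integer_multiple)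
  then obtain g where d: "?d > 0" and g: "map_poly of_int g = smult (of_nat ?d) f" by blast
  have g_coeff: "of_int (coeff g l) = of_nat ?d * coeff f l" for l
    using arg_cong[OF g, of "\<lambda>p. coeff p l"] by (simp add: coeff_map_poly)
  let ?F = "smult (of_nat ?d) (map_poly of_rat f) :: 'p padic poly"
  have F_coeff: "coeff ?F l = of_int (coeff g l)" for l
    using arg_cong[OF g_coeff[of l], of "of_rat :: rat \<Rightarrow> 'p padic"]
    by (simp add: coeff_map_poly of_rat_mult)
  have "\<exists>l. \<not> int ?p dvd coeff g l"
  proof (rule ccontr)
    assume "\<not> ?thesis"
    then have "[:int ?p:] dvd g" by (simp add: const_poly_dvd_iff)
    then obtain g' where g': "g = smult (int ?p) g'" by (auto elim!: dvdE)
    have "coeff g (degree f) = int ?d" using g_coeff[of "degree f"] monic by (simp flip: of_int_eq_iff[where 'a=rat])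
    then have "int ?p dvd int ?d" by (metis g' coeff_smult dvd_triv_left)
    then obtain d' where d': "?d = ?p * d'" by (auto elim!: dvdE)
    have "map_poly of_int g' = smult (of_nat d') f"
    proof (rule poly_eqI)
      fix l
      have "rat_of_int (int ?p * coeff g' l) = of_nat (?p * d') * coeff f l"
        using g_coeff[of l] unfolding d'[symmetric] by (simp add: g')
      then show "coeff (map_poly of_int g') l = coeff (smult (of_nat d') f) l"
        by (simp add: coeff_map_poly)
    qed
    moreover have "d' > 0" using d d' by (cases d') auto
    ultimately have "?d \<le> d'" unfolding poly_denom_def by (intro Least_le) blast
    then show False using d' \<open>d' > 0\<close> prime_gt_1_nat[OF prime_card[where 'a='p]] by simp
  qed
  then obtain l where l: "\<not> int ?p dvd coeff g l" by blast
  have "gauss_norm ?F = 1"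
  proof (rule antisym)
    show "gauss_norm ?F \<le> 1" unfolding gauss_norm_le_iff F_coeff by (simp add: padic_norm_of_int_le_1)
    show "1 \<le> gauss_norm ?F"
      using coeff_le_gauss_norm[of ?F l] unfolding F_coeff by (simp add: padic_norm_of_int_eq_1[OF l])
  qed
  then show ?thesis by (simp add: gauss_norm_smult)
qed

lemma lead_coeff_int_charpoly:
  fixes \<phi> :: "rat ^ 'n \<Rightarrow> rat ^ 'n"
  shows "coeff (int_charpoly \<phi>) CARD('n) = int (poly_denom (charpoly (matrix \<phi>)))"
proof -
  let ?f = "charpoly (matrix \<phi>)"
  have "poly_denom ?f > 0 \<and> (\<exists>g. map_poly of_int g = smult (of_nat (poly_denom ?f)) ?f)"
    unfolding poly_denom_def by (rule LeastI_ex) (rule exists_integer_multiple)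
  then obtain g where g: "map_poly of_int g = smult (of_nat (poly_denom ?f)) ?f" by blast
  have "g' = g" if "map_poly of_int g' = smult (of_nat (poly_denom ?f)) ?f" for g'
  proof (rule poly_eqI)
    fix l show "coeff g' l = coeff g l"
      using arg_cong[OF that[folded g], of "\<lambda>p. coeff p l"] by (simp add: coeff_map_poly)
  qed
  then have "int_charpoly \<phi> = g" unfolding int_charpoly_def Let_def using g by (intro the_equality)
  moreover have "rat_of_int (coeff g CARD('n)) = of_int (int (poly_denom ?f))"
    using arg_cong[OF g, of "\<lambda>p. coeff p CARD('n)"] charpoly_degree_coeff[of "matrix \<phi>"]
    by (simp add: coeff_map_poly)
  ultimately show ?thesis by (simp only: of_int_eq_iff)
qed

theorem mainTheorem4:
  fixes \<phi> :: "rat ^ 'n \<Rightarrow> rat ^ 'n"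
    and s :: int
    and M :: "('p::prime_card padic ^ 'n) measure"
  assumes "\<And>x y. \<phi> (x + y) = \<phi> x + \<phi> y"
    and "s = Polynomial.coeff (int_charpoly \<phi>) CARD('n)"
    and "haar_measure M"
  shows "alg_entropy M (padic_extension \<phi>) = ereal (ln (padic_norm (1 / of_int s :: 'p padic)))"
proof -
  let ?f = "charpoly (matrix \<phi>)" and ?A = "map_matrix of_rat (matrix \<phi>) :: 'p padic ^ 'n ^ 'n"
  have "padic_norm (of_int s :: 'p padic) * gauss_norm (charpoly ?A) = 1"
    using gauss_norm_poly_denom[OF charpoly_degree_coeff(2), of "matrix \<phi>", where 'p='p]
    by (simp add: assms(2) lead_coeff_int_charpoly charpoly_of_rat)
  moreover from this have "padic_norm (of_int s :: 'p padic) \<noteq> 0" by auto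
  ultimately have "padic_norm (1 / of_int s :: 'p padic) = gauss_norm (charpoly ?A)"
    by (simp add: padic_norm_divide field_simps del: padic_norm_eq_0)
  moreover have "padic_extension \<phi> = (*v) ?A" by (simp add: fun_eq_iff padic_extension_def)
  ultimately show ?thesis using alg_entropy_matrix[OF assms(3), of ?A] by simp
qed

end
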